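(* For each $k \in \mathbb{N}$, the Destructive Shift Bribery problem for the $k$-Approval rule is in $\mathrm{P}$ (i.e., decidable in polynomial time).
   Context: **Elections.** An election is a pair $E=(C,V)$, where $C=\{c_1,\dots,c_m\}$ is a finite set of candidates and $V=\{v_1,\dots,v_n\}$ is a finite multiset of voters; each voter $v$ has a strict ranking (preference order) of all candidates from best to worst, and $\mathrm{pos}_v(c)\in\{1,\dots,m\}$ is the position of $c$ in $v$'s ranking (1 = best). An election rule $\mathcal{R}$ maps each election $E$ to a set $\mathcal{R}(E)\subseteq C$ of (tied) winners; $c$ is the unique winner if $\mathcal{R}(E)=\{c\}$. **Destructive Shift Bribery for $\mathcal{R}$.** Input: an election $E=(C,V)$ with $m$ candidates and $n$ voters, a despised candidate $d\in C$, a budget $B$ (a nonnegative integer), and for each voter $v_i$ a price function $\rho_i$. Shifting $d$ back by $t$ positions in a vote moves $d$ $t$ places towards the end of the ranking, each passed candidate moving up by one place and all else unchanged. A price function for a voter $v$ with $j=\mathrm{pos}_v(d)$ is $\rho:\mathbb{N}\to\mathbb{N}\cup\{+\infty\}$ with $\rho(0)=0$, $\rho(i)\le\rho(i')$ for $i<i'\le m-j$, and $\rho(i)=+\infty$ for $i>m-j$; $\rho(i)$ is the cost of shifting $d$ back by $i$ positions in $v$'s ranking. Price functions are encoded by listing their values at all arguments where they are finite; numbers are in binary. Question: are there nonnegative integers $t_1,\dots,t_n$ with $\sum_i\rho_i(t_i)\le B$ such that, after shifting $d$ back by $t_i$ positions in the ranking of each $v_i$, $d$ is not the unique $\mathcal{R}$-winner?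 **$k$-Approval.** A scoring protocol for $m$ candidates is a vector $\alpha=(\alpha_1,\dots,\alpha_m)$ of nonincreasing, nonnegative integers; the score of $c$ is $\sum_{v\in V}\alpha_{\mathrm{pos}_v(c)}$, and the candidates with the highest score are the winners. The $k$-Approval rule uses the vector of $k$ ones followed by $m-k$ zeros. *)

theory Defs
  imports
    "HOL-Library.Multiset"
    "HOL-Library.Extended_Nat"
    "HOL-Computational_Algebra.Polynomial"
begin

section \<open>Deterministic multitape Turing machines and the class P\<close>

datatype 'a cell = Blank | Inp 'a | Aux nat

datatype move = Left | Stay | Right

record 'a tm =
  num_tapes :: nat
  states :: "nat set"
  alphabet :: "'a cell set"
  trans :: "nat \<Rightarrow> 'a cell list \<Rightarrow> nat \<times> ('a cell \<times> move) list"
  start :: nat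
  accept :: nat
  reject :: nat

text \<open>The transition function is a total function in HOL, but only its values on the finitely many
  arguments constrained below can ever be used in a run.\<close>

definition wf_tm :: "('a::finite) tm \<Rightarrow> bool" where
  "wf_tm M \<longleftrightarrow>
     num_tapes M \<ge> 1 \<and>
     finite (states M) \<and> {start M, accept M, reject M} \<subseteq> states M \<and> accept M \<noteq> reject M \<and>
     finite (alphabet M) \<and> Blank \<in> alphabet M \<and> range Inp \<subseteq> alphabet M \<and>
     (\<forall>q \<in> states M - {accept M, reject M}. \<forall>rs.
        length rs = num_tapes M \<and> set rs \<subseteq> alphabet M \<longrightarrow>
        (case trans M q rs of (q', as) \<Rightarrow>
           q' \<in> states M \<and> length as = num_tapes M \<and> fst ` set as \<subseteq> alphabet M))"

text \<open>Tapes are infinite in both directions; a tape is its contents together with the head position.\<close>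

type_synonym 'a tape = "(int \<Rightarrow> 'a cell) \<times> int"

fun read_tape :: "'a tape \<Rightarrow> 'a cell" where
  "read_tape (f, p) = f p"

fun act_tape :: "'a tape \<Rightarrow> 'a cell \<times> move \<Rightarrow> 'a tape" where
  "act_tape (f, p) (x, mv) =
     (f(p := x), p + (case mv of Left \<Rightarrow> - 1 | Stay \<Rightarrow> 0 | Right \<Rightarrow> 1))"

type_synonym 'a config = "nat \<times> 'a tape list"

fun step :: "'a tm \<Rightarrow> 'a config \<Rightarrow> 'a config" where
  "step M (q, ts) =
     (if q \<in> {accept M, reject M} then (q, ts)
      else case trans M q (map read_tape ts) of (q', as) \<Rightarrow> (q', map2 act_tape ts as))"

definition input_tape :: "'a list \<Rightarrow> 'a tape" where
  "input_tape w =
     ((\<lambda>i. if 0 \<le> i \<and> i < int (length w) then Inp (w ! nat i) else Blank), 0)"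

definition init_config :: "'a tm \<Rightarrow> 'a list \<Rightarrow> 'a config" where
  "init_config M w = (start M, input_tape w # replicate (num_tapes M - 1) ((\<lambda>_. Blank), 0))"

definition decides_in_time :: "'a tm \<Rightarrow> 'a list set \<Rightarrow> (nat \<Rightarrow> nat) \<Rightarrow> bool" where
  "decides_in_time M L T \<longleftrightarrow>
     (\<forall>w. \<exists>t \<le> T (length w).
        fst ((step M ^^ t) (init_config M w)) = (if w \<in> L then accept M else reject M))"

definition class_P :: "('a::finite) list set set" where
  "class_P = {L. \<exists>M (p :: nat poly). wf_tm M \<and> decides_in_time M L (poly p)}"


section \<open>Elections and scoring rules\<close>

text \<open>A preference order is the list of all candidates from best to worst.\<close>

definition is_ranking :: "'c set \<Rightarrow> 'c list \<Rightarrow> bool" where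
  "is_ranking C v \<longleftrightarrow> distinct v \<and> set v = C"

definition pos :: "'c list \<Rightarrow> 'c \<Rightarrow> nat" where
  "pos v c = Suc (length (takeWhile (\<lambda>x. x \<noteq> c) v))"

type_synonym 'c election_rule = "'c set \<Rightarrow> 'c list multiset \<Rightarrow> 'c set"

definition score :: "nat list \<Rightarrow> 'c list multiset \<Rightarrow> 'c \<Rightarrow> nat" where
  "score \<alpha> V c = (\<Sum>v\<in>#V. \<alpha> ! (pos v c - 1))"

definition scoring_rule :: "(nat \<Rightarrow> nat list) \<Rightarrow> 'c election_rule" where
  "scoring_rule \<alpha> C V =
     {c \<in> C. \<forall>c' \<in> C. score (\<alpha> (card C)) V c' \<le> score (\<alpha> (card C)) V c}"

text \<open>With fewer than \<open>k\<close> candidates, every position is worth one point.\<close>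

definition k_approval :: "nat \<Rightarrow> 'c election_rule" where
  "k_approval k = scoring_rule (\<lambda>m. replicate (min k m) 1 @ replicate (m - k) 0)"


section \<open>Destructive Shift Bribery\<close>

text \<open>If fewer than \<open>t\<close> candidates are ranked below \<open>d\<close>, then \<open>d\<close> is moved to the last place; this
  case never matters below, since such a shift has infinite price.\<close>

definition shift_back :: "'c \<Rightarrow> nat \<Rightarrow> 'c list \<Rightarrow> 'c list" where
  "shift_back d t v =
     (let xs = takeWhile (\<lambda>x. x \<noteq> d) v; ys = tl (dropWhile (\<lambda>x. x \<noteq> d) v)
      in xs @ take t ys @ d # drop t ys)"

definition price_function :: "nat \<Rightarrow> nat \<Rightarrow> (nat \<Rightarrow> enat) \<Rightarrow> bool" where
  "price_function m j \<rho> \<longleftrightarrow>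
     \<rho> 0 = 0 \<and>
     (\<forall>i i'. i < i' \<and> i' \<le> m - j \<longrightarrow> \<rho> i \<le> \<rho> i') \<and>
     (\<forall>i. i > m - j \<longrightarrow> \<rho> i = \<infinity>)"

record 'c dsb_instance =
  candidates :: "'c set"
  voters :: "('c list \<times> (nat \<Rightarrow> enat)) list"
  despised :: 'c
  budget :: nat

definition dsb_valid :: "'c dsb_instance \<Rightarrow> bool" where
  "dsb_valid I \<longleftrightarrow>
     finite (candidates I) \<and> despised I \<in> candidates I \<and>
     (\<forall>(v, \<rho>) \<in> set (voters I).
        is_ranking (candidates I) v \<and>
        price_function (card (candidates I)) (pos v (despised I)) \<rho>)"

definition dsb_yes :: "'c election_rule \<Rightarrow> 'c dsb_instance \<Rightarrow> bool" where
  "dsb_yes \<R> I \<longleftrightarrow>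
     (\<exists>t :: nat \<Rightarrow> nat.
        (\<Sum>i<length (voters I). snd (voters I ! i) (t i)) \<le> enat (budget I) \<and>
        \<R> (candidates I)
          (mset (map (\<lambda>i. shift_back (despised I) (t i) (fst (voters I ! i)))
                     [0..<length (voters I)]))
          \<noteq> {despised I})"


section \<open>Encoding of instances\<close>

datatype letter = Digit bool | Comma | Semi

instance letter :: finite
proof
  have "(UNIV :: letter set) = insert Comma (insert Semi (range Digit))"
    by (auto intro: letter.exhaust)
  then show "finite (UNIV :: letter set)"
    by (metis finite finite_imageI finite_insert)
qed

text \<open>Binary numerals, most significant digit first and without leading zeros; the numeral of \<open>0\<close>
  is the empty word.\<close>

fun binary :: "nat \<Rightarrow> letter list" where
  "binary n = (if n = 0 then [] else binary (n div 2) @ [Digit (odd n)])"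

declare binary.simps [simp del]

text \<open>Every number is terminated by \<open>Comma\<close> and every row by \<open>Semi\<close>, so a list of rows is
  recovered uniquely from its encoding.\<close>

definition encode_row :: "nat list \<Rightarrow> letter list" where
  "encode_row ns = concat (map (\<lambda>n. binary n @ [Comma]) ns) @ [Semi]"

text \<open>By monotonicity, a price function is finite exactly on an initial segment of the naturals,
  so the list of its finite values determines it.\<close>

definition finite_prices :: "(nat \<Rightarrow> enat) \<Rightarrow> nat list" where
  "finite_prices \<rho> = map (\<lambda>i. the_enat (\<rho> i)) (sorted_list_of_set {i. \<rho> i \<noteq> \<infinity>})"

text \<open>Candidate names are arbitrary natural numbers.\<close>

definition encode_instance :: "nat dsb_instance \<Rightarrow> letter list" where
  "encode_instance I =
     encode_row (sorted_list_of_set (candidates I)) @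
     encode_row [despised I, budget I] @
     concat (map (\<lambda>(v, \<rho>). encode_row v @ encode_row (finite_prices \<rho>)) (voters I))"

definition destructive_shift_bribery :: "nat election_rule \<Rightarrow> letter list set" where
  "destructive_shift_bribery \<R> = {encode_instance I | I. dsb_valid I \<and> dsb_yes \<R> I}"

end

theory Submission imports Defs begin

text \<open>For a rival \<open>c\<close> of the despised candidate \<open>d\<close>, a shift in one vote is worth
  \<open>1 + [c approved] - [d approved]\<close>, a number between \<open>0\<close> and \<open>2\<close>, and \<open>c\<close> catches up with \<open>d\<close> exactly
  if these numbers add up to at least the number \<open>n\<close> of voters. Hence the least cost of making
  \<open>c\<close> catch up is found by a dynamic program over the voters with a table indexed by \<open>0, \<dots>, n\<close>,
  which tries all shifts of finite price in every vote.

  On the machine side, a structured language of programs on stacks is executed step by step by a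
  multitape Turing machine. The functions on binary trees computed by such programs in polynomial
  time are closed under composition, pairing, case distinction and iteration with polynomially
  bounded intermediate results, and the algorithm is written with these means only.\<close>

section \<open>Stack programs\<close>

text \<open>Prices and the budget are written in binary, so a table indexed by cost could be
  exponentially long. Advantages are bounded by twice the number of voters, hence linearly in the
  input length; this is why the table is indexed by advantage and stores costs, as for knapsack with
  small profits. The summand \<open>1\<close> makes the difference of the approvals of
  \<open>c\<close> and \<open>d\<close> in a vote, which may be negative, a natural number; over
  \<open>n\<close> votes it contributes \<open>n\<close>, hence the threshold. Rivals can be treated
  one at a time, because \<open>d\<close> fails to be the unique winner as soon as a single rival
  has at least its score.

  \<open>class_P\<close> speaks of concrete machines and of all words. So time bounds are needed
  down to the arithmetic on bits, and malformed words have to be rejected as well. Iteration alone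
  does not preserve polynomial time, since repeated doubling of a list leads to exponential size;
  each loop therefore comes with a bound on its intermediate results.\<close>

type_synonym store = "nat \<Rightarrow> letter list"

datatype com =
  Skip
| Push nat letter
| Put nat letter
| Pop nat
| Seq com com  (infixr ";;" 60)
| If nat "letter option \<Rightarrow> bool" com com
| While nat "letter option \<Rightarrow> bool" com

definition peek :: "'a list \<Rightarrow> 'a option" where
  "peek w = (case w of [] \<Rightarrow> None | a # _ \<Rightarrow> Some a)"

lemma peek_simps [simp]: "peek [] = None" "peek (a # w) = Some a"
  by (simp_all add: peek_def)

text \<open>The command \<open>Put\<close> is the second half of a \<open>Push\<close>; it never occurs in a source program and
  has no big-step rule.\<close>

inductive exec :: "com \<Rightarrow> nat \<Rightarrow> store \<Rightarrow> store \<Rightarrow> bool" where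
  Skip: "exec Skip 1 s s"
| Push: "exec (Push r a) 2 s (s(r := a # s r))"
| Pop: "exec (Pop r) 1 s (s(r := tl (s r)))"
| Seq: "exec c t s s' \<Longrightarrow> exec d u s' s'' \<Longrightarrow> exec (c ;; d) (1 + t + u) s s''"
| IfTrue: "P (peek (s r)) \<Longrightarrow> exec c t s s' \<Longrightarrow> exec (If r P c d) (1 + t) s s'"
| IfFalse: "\<not> P (peek (s r)) \<Longrightarrow> exec d t s s' \<Longrightarrow> exec (If r P c d) (1 + t) s s'"
| WhileTrue: "P (peek (s r)) \<Longrightarrow> exec c t s s' \<Longrightarrow> exec (While r P c) u s' s'' \<Longrightarrow>
    exec (While r P c) (1 + t + u) s s''"
| WhileFalse: "\<not> P (peek (s r)) \<Longrightarrow> exec (While r P c) 1 s s"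

primrec regs :: "com \<Rightarrow> nat" where
  "regs Skip = 0"
| "regs (Push r a) = Suc r"
| "regs (Put r a) = Suc r"
| "regs (Pop r) = Suc r"
| "regs (Seq c d) = max (regs c) (regs d)"
| "regs (If r P c d) = max (Suc r) (max (regs c) (regs d))"
| "regs (While r P c) = max (Suc r) (regs c)"


section \<open>Compiling stack programs to Turing machines\<close>

text \<open>The control state of the machine is the list of commands that remain to be executed; only
  finitely many such lists are reachable.\<close>

primrec conts :: "com \<Rightarrow> com list \<Rightarrow> com list set" where
  "conts Skip K = {Skip # K}"
| "conts (Push r a) K = {Push r a # K, Put r a # K}"
| "conts (Put r a) K = {Put r a # K}"
| "conts (Pop r) K = {Pop r # K}"
| "conts (Seq c d) K = insert (Seq c d # K) (conts c (d # K) \<union> conts d K)"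
| "conts (If r P c d) K = insert (If r P c d # K) (conts c K \<union> conts d K)"
| "conts (While r P c) K = insert (While r P c # K) (conts c (While r P c # K))"

lemma finite_conts [simp]: "finite (conts c K)"
  by (induction c arbitrary: K) auto

lemma self_in_conts [simp]: "c # K \<in> conts c K"
  by (cases c) auto

fun letter_of :: "'a cell \<Rightarrow> 'a option" where
  "letter_of (Inp a) = Some a"
| "letter_of _ = None"

definition stay :: "'a cell list \<Rightarrow> ('a cell \<times> move) list" where
  "stay rs = map (\<lambda>x. (x, Stay)) rs"

text \<open>The head rests on the top of the stack, which extends to the right. A machine step
  writes before it moves, so a push takes two steps: the first keeps the scanned cell and moves
  left, the second, \<open>Put\<close>, writes the new letter. This is the time 2 of
  \<open>Push\<close> in \<open>exec\<close>.\<close>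

fun delta :: "com list \<Rightarrow> letter cell list \<Rightarrow> com list \<times> (letter cell \<times> move) list" where
  "delta [] rs = ([], stay rs)"
| "delta (Skip # K) rs = (K, stay rs)"
| "delta (Push r a # K) rs = (Put r a # K, (stay rs)[r := (rs ! r, Left)])"
| "delta (Put r a # K) rs = (K, (stay rs)[r := (Inp a, Stay)])"
| "delta (Pop r # K) rs = (K, (stay rs)[r := (Blank, Right)])"
| "delta (Seq c d # K) rs = (c # d # K, stay rs)"
| "delta (If r P c d # K) rs = ((if P (letter_of (rs ! r)) then c else d) # K, stay rs)"
| "delta (While r P c # K) rs =
     (if P (letter_of (rs ! r)) then c # While r P c # K else K, stay rs)"

text \<open>Control leaves \<open>c\<close> only towards its continuation \<open>K\<close>. The
  induction needs arbitrary \<open>K\<close>: the first half of a sequence has the second half in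
  its continuation, and the body of a loop has the loop itself.\<close>

lemma delta_in_conts: "K' \<in> conts c K \<Longrightarrow> fst (delta K' rs) \<in> insert K (conts c K)"
proof (induction c arbitrary: K)
  case (Seq c d)
  then have "K' = Seq c d # K \<or> K' \<in> conts c (d # K) \<or> K' \<in> conts d K" by simp
  then show ?case
    using Seq.IH(1)[of "d # K"] Seq.IH(2)[of K] self_in_conts[of d K]
      self_in_conts[of c "d # K"] by auto
next
  case (If r P c d)
  then have "K' = If r P c d # K \<or> K' \<in> conts c K \<or> K' \<in> conts d K" by simp
  then show ?case
    using If.IH[of K] by auto
next
  case (While r P c)
  then have "K' = While r P c # K \<or> K' \<in> conts c (While r P c # K)" by simp
  then show ?case
    using While.IH[of "While r P c # K"] self_in_conts[of c "While r P c # K"]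
    by (cases "P (letter_of (rs ! r))") auto
qed auto

lemma length_delta: "length (snd (delta K rs)) = length rs"
proof (cases K)
  case (Cons c K')
  then show ?thesis by (cases c) (simp_all add: stay_def)
qed (simp add: stay_def)

lemma delta_cells:
  assumes "set rs \<subseteq> insert Blank (range Inp)"
  shows "fst ` set (snd (delta K rs)) \<subseteq> insert Blank (range Inp)"
proof -
  have 1: "fst ` set (stay rs) \<subseteq> insert Blank (range Inp)"
    using assms by (auto simp: stay_def)
  have 2: "fst ` set ((stay rs)[r := (x, mv)]) \<subseteq> insert Blank (range Inp)"
    if "x \<in> insert Blank (range Inp)" for r x mv
  proof -
    have "fst ` set ((stay rs)[r := (x, mv)]) \<subseteq> fst ` insert (x, mv) (set (stay rs))"
      by (intro image_mono set_update_subset_insert)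
    also have "\<dots> \<subseteq> insert Blank (range Inp)"
      using that 1 by simp
    finally show ?thesis .
  qed
  have 3: "fst ` set ((stay rs)[r := (rs ! r, mv)]) \<subseteq> insert Blank (range Inp)" for r mv
  proof (cases "r < length rs")
    case True
    then have "rs ! r \<in> insert Blank (range Inp)"
      using assms nth_mem by blast
    then show ?thesis by (rule 2)
  next
    case False
    then have "(stay rs)[r := (rs ! r, mv)] = stay rs"
      by (intro list_update_beyond) (simp add: stay_def)
    then show ?thesis using 1 by simp
  qed
  show ?thesis
  proof (cases K)
    case (Cons c K')
    then show ?thesis by (cases c) (simp_all add: 1 2 3)
  qed (simp add: 1)
qed

definition ctrl :: "com \<Rightarrow> com list set" where
  "ctrl c = insert [] (conts c [])"

text \<open>The codes of control lists are shifted by 2 to keep 0 and 1 for acceptance and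
  rejection. The empty list is the state after the program has ended; its single step turns the top
  letter of register 0 into the verdict.\<close>

definition machine :: "nat \<Rightarrow> com \<Rightarrow> (com list \<Rightarrow> nat) \<Rightarrow> letter tm" where
  "machine n c code =
     \<lparr>num_tapes = n, states = {0, 1} \<union> (\<lambda>K. code K + 2) ` ctrl c,
      alphabet = insert Blank (range Inp),
      trans = (\<lambda>q rs. let K = inv_into (ctrl c) code (q - 2) in
        if K = [] then (if letter_of (rs ! 0) = Some (Digit True) then 0 else 1, stay rs)
        else (code (fst (delta K rs)) + 2, snd (delta K rs))),
      start = code [c] + 2, accept = 0, reject = 1\<rparr>"

lemma machine_simps [simp]:
  "num_tapes (machine n c code) = n"
  "states (machine n c code) = {0, 1} \<union> (\<lambda>K. code K + 2) ` ctrl c"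
  "alphabet (machine n c code) = insert Blank (range Inp)"
  "start (machine n c code) = code [c] + 2"
  "accept (machine n c code) = 0"
  "reject (machine n c code) = 1"
  by (simp_all add: machine_def)

lemma trans_machine:
  assumes "inj_on code (ctrl c)" "K \<in> ctrl c"
  shows "trans (machine n c code) (code K + 2) rs =
    (if K = [] then (if letter_of (rs ! 0) = Some (Digit True) then 0 else 1, stay rs)
     else (code (fst (delta K rs)) + 2, snd (delta K rs)))"
  using assms by (simp add: machine_def Let_def)

lemma wf_machine:
  assumes "inj_on code (ctrl c)" "n \<ge> 1"
  shows "wf_tm (machine n c code)"
proof -
  let ?M = "machine n c code"
  have *: "case trans ?M q rs of (q', as) \<Rightarrow>
      q' \<in> states ?M \<and> length as = n \<and> fst ` set as \<subseteq> insert Blank (range Inp)"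
    if q: "q \<in> states ?M - {accept ?M, reject ?M}"
      and rs: "length rs = n" "set rs \<subseteq> insert Blank (range Inp)" for q rs
  proof -
    obtain K where K: "K \<in> ctrl c" "q = code K + 2"
      using q by auto
    show ?thesis
    proof (cases "K = []")
      case True
      have "fst ` set (stay rs) \<subseteq> insert Blank (range Inp)" "length (stay rs) = n"
        using rs by (auto simp: stay_def)
      with True K show ?thesis
        by (simp only: trans_machine[OF assms(1)]) simp
    next
      case False
      with K(1) have K': "K \<in> conts c []" by (simp add: ctrl_def)
      have "fst (delta K rs) \<in> ctrl c"
        using delta_in_conts[OF K'] by (simp add: ctrl_def)
      with False K rs delta_cells[OF rs(2), of K] show ?thesis
        by (simp only: trans_machine[OF assms(1)]) (simp add: length_delta)
    qed
  qed
  have tr: "\<forall>q \<in> states ?M - {accept ?M, reject ?M}. \<forall>rs.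
      length rs = num_tapes ?M \<and> set rs \<subseteq> alphabet ?M \<longrightarrow>
      (case trans ?M q rs of (q', as) \<Rightarrow>
        q' \<in> states ?M \<and> length as = num_tapes ?M \<and> fst ` set as \<subseteq> alphabet ?M)"
    unfolding machine_simps(1,3) by (intro ballI allI impI, elim conjE) (rule *)
  have st: "num_tapes ?M \<ge> 1" "finite (states ?M)" "accept ?M \<noteq> reject ?M"
    using assms(2) by (simp_all add: ctrl_def)
  have al: "finite (alphabet ?M)" "Blank \<in> alphabet ?M" "range Inp \<subseteq> alphabet ?M"
    unfolding machine_simps by (rule finite.insertI, rule finite_imageI, rule finite, rule insertI1, rule subset_insertI)
  have ss: "{start ?M, accept ?M, reject ?M} \<subseteq> states ?M"
    by (simp add: ctrl_def)
  show ?thesis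
    unfolding wf_tm_def by (intro conjI st al ss tr)
qed

section \<open>Stacks represented by tapes\<close>

definition tape_rep :: "letter tape \<Rightarrow> letter list \<Rightarrow> bool" where
  "tape_rep T w \<longleftrightarrow>
     (\<forall>i. fst T (snd T + int i) = (if i < length w then Inp (w ! i) else Blank))"

lemma tape_rep_peek: "tape_rep T w \<Longrightarrow> letter_of (read_tape T) = peek w"
  by (cases T; cases w) (auto simp: tape_rep_def dest: spec[of _ 0])

text \<open>\<open>tape_rep\<close> constrains only the cells from the head to the right, so
  whatever stands to the left is harmless: the cell that is entered gets overwritten.\<close>

lemma tape_rep_push:
  assumes "tape_rep T w"
  shows "tape_rep (act_tape (act_tape T (read_tape T, Left)) (Inp a, Stay)) (a # w)"
proof (cases T)
  case (Pair f p)
  show ?thesis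
    unfolding tape_rep_def
  proof
    fix i
    show "fst (act_tape (act_tape T (read_tape T, Left)) (Inp a, Stay))
        (snd (act_tape (act_tape T (read_tape T, Left)) (Inp a, Stay)) + int i) =
      (if i < length (a # w) then Inp ((a # w) ! i) else Blank)"
      using assms Pair by (cases i) (auto simp: tape_rep_def)
  qed
qed

lemma tape_rep_pop:
  assumes "tape_rep T w"
  shows "tape_rep (act_tape T (Blank, Right)) (tl w)"
proof (cases T)
  case (Pair f p)
  have "f (p + 1 + int i) = (if i < length (tl w) then Inp (tl w ! i) else Blank)" for i
    using assms[unfolded tape_rep_def, rule_format, of "Suc i"] Pair
    by (cases w) (auto simp: add.commute add.left_commute)
  then show ?thesis
    using Pair by (auto simp: tape_rep_def)
qed

definition tapes_rep :: "nat \<Rightarrow> letter tape list \<Rightarrow> store \<Rightarrow> bool" where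
  "tapes_rep n ts s \<longleftrightarrow> length ts = n \<and> (\<forall>i<n. tape_rep (ts ! i) (s i))"

lemma act_read [simp]: "act_tape T (read_tape T, Stay) = T"
  by (cases T) simp

lemma act_stay: "map2 act_tape ts (stay (map read_tape ts)) = ts"
  by (induction ts) (simp_all add: stay_def)

lemma act_update:
  assumes "r < length ts"
  shows "map2 act_tape ts ((stay (map read_tape ts))[r := x]) = ts[r := act_tape (ts ! r) x]"
proof (rule nth_equalityI)
  fix i
  assume "i < length (map2 act_tape ts ((stay (map read_tape ts))[r := x]))"
  then show "map2 act_tape ts ((stay (map read_tape ts))[r := x]) ! i =
      ts[r := act_tape (ts ! r) x] ! i"
    using assms by (cases "i = r") (simp_all add: stay_def)
qed (simp add: stay_def)

definition conf :: "(com list \<Rightarrow> nat) \<Rightarrow> com list \<Rightarrow> letter tape list \<Rightarrow> letter config" where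
  "conf code K ts = (code K + 2, ts)"

lemma step_machine:
  assumes "inj_on code (ctrl c)" "K \<in> ctrl c" "K \<noteq> []"
  shows "step (machine n c code) (conf code K ts) =
    conf code (fst (delta K (map read_tape ts)))
      (map2 act_tape ts (snd (delta K (map read_tape ts))))"
  using assms trans_machine[OF assms(1,2), of n "map read_tape ts"]
  by (simp add: conf_def split: prod.split)

lemma tapes_rep_update:
  "tapes_rep n ts s \<Longrightarrow> tape_rep T w \<Longrightarrow> tapes_rep n (ts[r := T]) (s(r := w))"
  by (auto simp: tapes_rep_def nth_list_update)

lemma funpow_trans: "(f ^^ t) x = y \<Longrightarrow> (f ^^ u) y = z \<Longrightarrow> (f ^^ (t + u)) x = z"
  by (subst add.commute) (simp add: funpow_add)

text \<open>The times agree exactly, by induction on the derivation. \<open>c0\<close> is the whole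
  program and fixes the states of the machine, while \<open>c\<close> runs through its parts; the
  inclusion says that \<open>c\<close> with continuation \<open>K\<close> occurs in it.\<close>

lemma machine_exec:
  assumes "exec c t s s'" "inj_on code (ctrl c0)" "regs c \<le> n"
    "insert K (conts c K) \<subseteq> ctrl c0" "tapes_rep n ts s"
  shows "\<exists>ts'. (step (machine n c0 code) ^^ t) (conf code (c # K) ts) = conf code K ts' \<and>
    tapes_rep n ts' s'"
  using assms
proof (induction arbitrary: K ts rule: exec.induct)
  case (Skip s)
  then have "(step (machine n c0 code) ^^ 1) (conf code (Skip # K) ts) = conf code K ts"
    by (simp del: step.simps add: step_machine act_stay)
  with Skip show ?case by blast
next
  case (Push r a s)
  then have r: "r < length ts" by (simp add: tapes_rep_def)
  have "(step (machine n c0 code) ^^ 2) (conf code (Push r a # K) ts) =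
    conf code K (ts[r := act_tape (act_tape (ts ! r) (read_tape (ts ! r), Left)) (Inp a, Stay)])"
    using Push r by (simp del: step.simps add: numeral_2_eq_2 step_machine act_update)
  moreover have "tapes_rep n (ts[r := act_tape (act_tape (ts ! r) (read_tape (ts ! r), Left))
      (Inp a, Stay)]) (s(r := a # s r))"
    using Push r by (intro tapes_rep_update tape_rep_push) (auto simp: tapes_rep_def)
  ultimately show ?case by blast
next
  case (Pop r s)
  then have r: "r < length ts" by (simp add: tapes_rep_def)
  have "tapes_rep n (ts[r := act_tape (ts ! r) (Blank, Right)]) (s(r := tl (s r)))"
    using Pop r by (intro tapes_rep_update tape_rep_pop) (auto simp: tapes_rep_def)
  moreover have "(step (machine n c0 code) ^^ 1) (conf code (Pop r # K) ts) =
      conf code K (ts[r := act_tape (ts ! r) (Blank, Right)])"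
    using Pop r by (simp del: step.simps add: step_machine act_update)
  ultimately show ?case by blast
next
  case (Seq c t s s' d u s'')
  have 1: "(step (machine n c0 code) ^^ 1) (conf code ((c ;; d) # K) ts) = conf code (c # d # K) ts"
    using Seq.prems by (simp del: step.simps add: step_machine act_stay)
  have dK: "d # K \<in> ctrl c0"
    using Seq.prems(3) self_in_conts[of d K] unfolding conts.simps by blast
  obtain ts' where 2: "(step (machine n c0 code) ^^ t) (conf code (c # d # K) ts) = conf code (d # K) ts'"
    and r: "tapes_rep n ts' s'"
    using Seq.IH(1)[of "d # K" ts] Seq.prems dK by auto
  obtain ts'' where 3: "(step (machine n c0 code) ^^ u) (conf code (d # K) ts') = conf code K ts''"
    and "tapes_rep n ts'' s''"
    using Seq.IH(2)[of K ts'] Seq.prems r by auto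
  with funpow_trans[OF funpow_trans[OF 1 2] 3] show ?case by blast
next
  case (IfTrue P s r c t s' d)
  have "letter_of (map read_tape ts ! r) = peek (s r)"
    using IfTrue.prems by (auto simp: tapes_rep_def tape_rep_peek)
  then have 1: "(step (machine n c0 code) ^^ 1) (conf code (If r P c d # K) ts) = conf code (c # K) ts"
    using IfTrue by (simp del: step.simps add: step_machine act_stay)
  obtain ts' where 2: "(step (machine n c0 code) ^^ t) (conf code (c # K) ts) = conf code K ts'"
    and r: "tapes_rep n ts' s'"
    using IfTrue.IH[of K ts] IfTrue.prems by auto
  with funpow_trans[OF 1 2] show ?case by blast
next
  case (IfFalse P s r d t s' c)
  have "letter_of (map read_tape ts ! r) = peek (s r)"
    using IfFalse.prems by (auto simp: tapes_rep_def tape_rep_peek)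
  then have 1: "(step (machine n c0 code) ^^ 1) (conf code (If r P c d # K) ts) = conf code (d # K) ts"
    using IfFalse by (simp del: step.simps add: step_machine act_stay)
  obtain ts' where 2: "(step (machine n c0 code) ^^ t) (conf code (d # K) ts) = conf code K ts'"
    and r: "tapes_rep n ts' s'"
    using IfFalse.IH[of K ts] IfFalse.prems by auto
  with funpow_trans[OF 1 2] show ?case by blast
next
  case (WhileTrue P s r c t s' u s'')
  have "letter_of (map read_tape ts ! r) = peek (s r)"
    using WhileTrue.prems by (auto simp: tapes_rep_def tape_rep_peek)
  then have 1: "(step (machine n c0 code) ^^ 1) (conf code (While r P c # K) ts) =
      conf code (c # While r P c # K) ts"
    using WhileTrue by (simp del: step.simps add: step_machine act_stay)
  obtain ts' where 2: "(step (machine n c0 code) ^^ t) (conf code (c # While r P c # K) ts) =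
      conf code (While r P c # K) ts'"
    and r: "tapes_rep n ts' s'"
    using WhileTrue.IH(1)[of "While r P c # K" ts] WhileTrue.prems by auto
  obtain ts'' where 3: "(step (machine n c0 code) ^^ u) (conf code (While r P c # K) ts') =
      conf code K ts''"
    and "tapes_rep n ts'' s''"
    using WhileTrue.IH(2)[of K ts'] WhileTrue.prems r by auto
  with funpow_trans[OF funpow_trans[OF 1 2] 3] show ?case by blast
next
  case (WhileFalse P s r c)
  have "letter_of (map read_tape ts ! r) = peek (s r)"
    using WhileFalse.prems by (auto simp: tapes_rep_def tape_rep_peek)
  then have "(step (machine n c0 code) ^^ 1) (conf code (While r P c # K) ts) = conf code K ts"
    using WhileFalse by (simp del: step.simps add: step_machine act_stay)
  with WhileFalse show ?case by blast
qed

lemma class_P_exec: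
  assumes "regs c \<le> n" "n \<ge> 1"
    and "\<And>w. \<exists>t s. t \<le> poly p (length w) \<and> exec c t ((\<lambda>_. [])(0 := w)) s \<and>
      (peek (s 0) = Some (Digit True) \<longleftrightarrow> w \<in> L)"
  shows "L \<in> class_P"
proof -
  obtain code :: "com list \<Rightarrow> nat" where inj: "inj_on code (ctrl c)"
    using finite_imp_inj_to_nat_seg[of "ctrl c"] by (auto simp: ctrl_def)
  let ?M = "machine n c code"
  have "\<exists>t \<le> poly (p + 1) (length w).
      fst ((step ?M ^^ t) (init_config ?M w)) = (if w \<in> L then accept ?M else reject ?M)" for w
  proof -
    obtain t s where t: "t \<le> poly p (length w)" and ex: "exec c t ((\<lambda>_. [])(0 := w)) s"
      and res: "peek (s 0) = Some (Digit True) \<longleftrightarrow> w \<in> L"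
      using assms(3) by blast
    have rep: "tapes_rep n (input_tape w # replicate (n - 1) ((\<lambda>_. Blank), 0)) ((\<lambda>_. [])(0 := w))"
      using assms(2)
      by (auto simp: tapes_rep_def tape_rep_def input_tape_def nth_Cons split: nat.split)
    have init: "init_config ?M w =
        conf code [c] (input_tape w # replicate (n - 1) ((\<lambda>_. Blank), 0))"
      by (simp add: init_config_def machine_def conf_def)
    obtain ts where ts: "(step ?M ^^ t) (init_config ?M w) = conf code [] ts"
      and r: "tapes_rep n ts s"
      using machine_exec[OF ex inj assms(1) _ rep, of "[]"] init by (auto simp: ctrl_def)
    have "letter_of (map read_tape ts ! 0) = peek (s 0)"
      using r assms(2) by (auto simp: tapes_rep_def tape_rep_peek)
    then have "fst (step ?M (conf code [] ts)) = (if w \<in> L then accept ?M else reject ?M)"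
      using inj res by (simp add: machine_def Let_def ctrl_def conf_def)
    then have "fst ((step ?M ^^ Suc t) (init_config ?M w)) = (if w \<in> L then accept ?M else reject ?M)"
      using ts by simp
    \<comment> \<open>The additional step is the one from the empty control list to the
      verdict.\<close>
    moreover have "Suc t \<le> poly (p + 1) (length w)"
      using t by simp
    ultimately show ?thesis by blast
  qed
  then have "decides_in_time ?M L (poly (p + 1))"
    unfolding decides_in_time_def by blast
  moreover have "wf_tm ?M"
    using inj assms(2) by (rule wf_machine)
  ultimately show ?thesis
    unfolding class_P_def by blast
qed

section \<open>Polynomial-time functions on encoded data\<close>

definition run :: "com \<Rightarrow> nat \<Rightarrow> store \<Rightarrow> store \<Rightarrow> bool" where
  "run c T s s' \<longleftrightarrow> (\<exists>t\<le>T. exec c t s s')"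

lemma run_mono: "run c T s s' \<Longrightarrow> T \<le> T' \<Longrightarrow> run c T' s s'"
  unfolding run_def using le_trans by blast

lemma run_conv: "run c T s s' \<Longrightarrow> s' = s'' \<Longrightarrow> T \<le> T' \<Longrightarrow> run c T' s s''"
  using run_mono by blast

lemma run_Skip: "run Skip 1 s s"
  unfolding run_def using exec.Skip by blast

lemma run_Push: "run (Push r a) 2 s (s(r := a # s r))"
  unfolding run_def using exec.Push by blast

lemma run_Pop: "run (Pop r) 1 s (s(r := tl (s r)))"
  unfolding run_def using exec.Pop by blast

lemma run_Seq: "run c T s s' \<Longrightarrow> run d U s' s'' \<Longrightarrow> run (c ;; d) (1 + T + U) s s''"
  unfolding run_def by (metis exec.Seq add_mono le_refl)

lemma run_If:
  "(P (peek (s r)) \<Longrightarrow> run c T s s') \<Longrightarrow> (\<not> P (peek (s r)) \<Longrightarrow> run d T s s') \<Longrightarrow>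
    run (If r P c d) (1 + T) s s'"
  unfolding run_def by (cases "P (peek (s r))") (blast intro: exec.IfTrue exec.IfFalse add_left_mono)+

lemma run_WhileTrue:
  "P (peek (s r)) \<Longrightarrow> run c T s s' \<Longrightarrow> run (While r P c) U s' s'' \<Longrightarrow>
    run (While r P c) (1 + T + U) s s''"
  unfolding run_def by (metis exec.WhileTrue add_mono le_refl)

lemma run_WhileFalse: "\<not> P (peek (s r)) \<Longrightarrow> run (While r P c) 1 s s"
  unfolding run_def using exec.WhileFalse by blast

text \<open>A program can test the top letter but cannot pass it as an argument. As there are only
  four letters, a family of programs indexed by letters becomes one program by testing for them in
  turn.\<close>

definition switch :: "nat \<Rightarrow> (letter \<Rightarrow> com) \<Rightarrow> com" where
  "switch r f =
     If r (\<lambda>x. x = Some (Digit True)) (f (Digit True))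
       (If r (\<lambda>x. x = Some (Digit False)) (f (Digit False))
         (If r (\<lambda>x. x = Some Comma) (f Comma) (f Semi)))"

lemma letter_cases:
  obtains "a = Digit True" | "a = Digit False" | "a = Comma" | "a = Semi"
  by (metis letter.exhaust)

lemma run_switch:
  assumes "s r = a # w" "run (f a) T s s'"
  shows "run (switch r f) (3 + T) s s'"
proof -
  have p: "peek (s r) = Some a" using assms(1) by simp
  have r: "run (f a) U s s'" if "T \<le> U" for U
    using assms(2) that by (rule run_mono)
  have "run (switch r f) (1 + (1 + (1 + T))) s s'"
    unfolding switch_def
    by (rule run_If[OF _ run_If[OF _ run_If]]; cases a rule: letter_cases) (use p r in simp_all)
  then show ?thesis by (rule run_mono) simp
qed

lemma regs_switch: "(\<And>a. regs (f a) \<le> n) \<Longrightarrow> r < n \<Longrightarrow> regs (switch r f) \<le> n"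
  by (simp add: switch_def)

primrec pushes :: "nat \<Rightarrow> letter list \<Rightarrow> com" where
  "pushes r [] = Skip"
| "pushes r (a # w) = pushes r w ;; Push r a"

lemma run_pushes: "run (pushes r w) (3 * length w + 1) s (s(r := w @ s r))"
proof (induction w)
  case (Cons a w)
  show ?case
    unfolding pushes.simps by (rule run_conv[OF run_Seq[OF Cons run_Push]]) (simp_all add: fun_eq_iff)
qed (use run_Skip in simp)

lemma regs_pushes: "regs (pushes r w) \<le> Suc r"
  by (induction w) auto

definition clear :: "nat \<Rightarrow> com" where
  "clear r = While r (\<lambda>x. x \<noteq> None) (Pop r)"

lemma run_clear: "run (clear r) (2 * length (s r) + 1) s (s(r := []))"
proof (induction "s r" arbitrary: s)
  case Nil
  then show ?case
    using run_WhileFalse[of "\<lambda>x. x \<noteq> None" s r] fun_upd_triv[of s r] by (simp add: clear_def)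
next
  case (Cons a w)
  have "run (clear r) (1 + 1 + (2 * length w + 1)) s (s(r := []))"
    unfolding clear_def
  proof (rule run_WhileTrue[OF _ run_Pop])
    show "peek (s r) \<noteq> None" using Cons.hyps(2)[symmetric] by simp
    show "run (While r (\<lambda>x. x \<noteq> None) (Pop r)) (2 * length w + 1) (s(r := tl (s r))) (s(r := []))"
      using Cons.hyps(1)[of "s(r := tl (s r))"] Cons.hyps(2)[symmetric] by (simp add: clear_def)
  qed
  then show ?case using Cons.hyps(2)[symmetric] by simp
qed

definition transfer :: "nat \<Rightarrow> (letter \<Rightarrow> com) \<Rightarrow> com" where
  "transfer r f = While r (\<lambda>x. x \<noteq> None) (switch r f ;; Pop r)"

lemma regs_transfer: "(\<And>a. regs (f a) \<le> n) \<Longrightarrow> r < n \<Longrightarrow> regs (transfer r f) \<le> n"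
  by (simp add: transfer_def regs_switch)

text \<open>As \<open>g\<close> neither changes register \<open>r\<close> nor depends on it, the
  pops between its applications can be merged into one emptying of \<open>r\<close> at the end. The
  6 extra steps per letter are 3 for \<open>switch\<close> and one each for \<open>Seq\<close>,
  \<open>Pop\<close> and the loop test.\<close>

lemma run_transfer:
  assumes f: "\<And>a s. run (f a) T s (g a s)"
    and g: "\<And>a s. g a s r = s r"
    and comm: "\<And>a s w. g a (s(r := w)) = (g a s)(r := w)"
  shows "run (transfer r f) ((T + 6) * length (s r) + 1) s ((fold g (s r) s)(r := []))"
proof (induction "s r" arbitrary: s)
  case Nil
  then show ?case
    using run_WhileFalse[of "\<lambda>x. x \<noteq> None" s r] fun_upd_triv[of s r] by (simp add: transfer_def)
next
  case (Cons a w)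
  let ?s = "(g a s)(r := w)"
  have "fold g w (s(r := v)) = (fold g w s)(r := v)" for w s v
    by (induction w arbitrary: s) (simp_all add: comm del: fun_upd_apply)
  then have eq: "(fold g w ?s)(r := []) = (fold g w (g a s))(r := [])"
    by simp
  have "run (switch r f ;; Pop r) (1 + (3 + T) + 1) s ?s"
    by (rule run_conv[OF run_Seq[OF run_switch[where f = f, OF Cons.hyps(2)[symmetric] f[of a s]] run_Pop]])
      (use Cons.hyps(2)[symmetric] in \<open>simp_all add: g\<close>)
  then have "run (transfer r f) (1 + (1 + (3 + T) + 1) + ((T + 6) * length w + 1)) s
      ((fold g w (g a s))(r := []))"
    unfolding transfer_def
  proof (rule run_WhileTrue[rotated])
    show "peek (s r) \<noteq> None" using Cons.hyps(2)[symmetric] by simp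
    show "run (While r (\<lambda>x. x \<noteq> None) (switch r f;; Pop r)) ((T + 6) * length w + 1)
        ((g a s)(r := w)) ((fold g w (g a s))(r := []))"
      using Cons.hyps(1)[of ?s] eq by (simp add: transfer_def)
  qed
  then show ?case
    using Cons.hyps(2)[symmetric] by (simp add: algebra_simps)
qed

definition move :: "nat \<Rightarrow> nat \<Rightarrow> com" where
  "move r r' = transfer r (Push r')"

lemma run_move:
  assumes "r \<noteq> r'"
  shows "run (move r r') (8 * length (s r) + 1) s (s(r := [], r' := rev (s r) @ s r'))"
proof -
  have g: "fold (\<lambda>a s. s(r' := a # s r')) w s = s(r' := rev w @ s r')"
    for w :: "letter list" and s :: store
    by (induction w arbitrary: s) auto
  have "(fold (\<lambda>a s. s(r' := a # s r')) (s r) s)(r := []) = s(r := [], r' := rev (s r) @ s r')"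
    unfolding g using assms by (auto simp: fun_eq_iff)
  moreover have "run (move r r') ((2 + 6) * length (s r) + 1) s
      ((fold (\<lambda>a s. s(r' := a # s r')) (s r) s)(r := []))"
    unfolding move_def by (rule run_transfer[OF run_Push]) (use assms in auto)
  ultimately show ?thesis
    by (elim run_conv) simp_all
qed

definition copy :: "nat \<Rightarrow> nat \<Rightarrow> nat \<Rightarrow> com" where
  "copy r r1 r2 = transfer r (\<lambda>a. Push r1 a ;; Push r2 a)"

lemma run_copy:
  assumes "r \<noteq> r1" "r \<noteq> r2" "r1 \<noteq> r2"
  shows "run (copy r r1 r2) (11 * length (s r) + 1) s
    (s(r := [], r1 := rev (s r) @ s r1, r2 := rev (s r) @ s r2))"
proof -
  let ?g = "\<lambda>a s. s(r1 := a # s r1, r2 := a # s r2)"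
  have g: "fold ?g w s = s(r1 := rev w @ s r1, r2 := rev w @ s r2)"
    for w :: "letter list" and s :: store
    using assms by (induction w arbitrary: s) (auto simp: fun_upd_twist)
  have "run (copy r r1 r2) ((5 + 6) * length (s r) + 1) s ((fold ?g (s r) s)(r := []))"
    unfolding copy_def
  proof (rule run_transfer)
    show "run (Push r1 a ;; Push r2 a) 5 s (?g a s)" for a s
      by (rule run_conv[OF run_Seq[OF run_Push run_Push]]) (use assms in auto)
  qed (use assms in \<open>auto simp: fun_upd_twist\<close>)
  moreover have "(fold ?g (s r) s)(r := []) =
      s(r := [], r1 := rev (s r) @ s r1, r2 := rev (s r) @ s r2)"
    unfolding g using assms by (auto simp: fun_eq_iff)
  ultimately show ?thesis by simp
qed

text \<open>Data are binary trees, written on a tape in preorder; this code is prefix-free, so the two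
  components of a pair can be separated by counting.\<close>

datatype tree = Leaf | Node tree tree

primrec code :: "tree \<Rightarrow> letter list" where
  "code Leaf = [Digit False]"
| "code (Node a b) = Digit True # code a @ code b"

class enc =
  fixes to_tree :: "'a \<Rightarrow> tree"

abbreviation (input) encode :: "'a::enc \<Rightarrow> letter list" where
  "encode x \<equiv> code (to_tree x)"

definition esize :: "'a::enc \<Rightarrow> nat" where
  "esize x = length (encode x)"

lemma esize_pos: "esize x > 0"
  by (cases "to_tree x") (simp_all add: esize_def)

instantiation prod :: (enc, enc) enc
begin
definition "to_tree p = Node (to_tree (fst p)) (to_tree (snd p))"
instance ..
end

instantiation list :: (enc) enc
begin
primrec to_tree_list where
  "to_tree_list [] = Leaf"
| "to_tree_list (x # xs) = Node (to_tree x) (to_tree_list xs)"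
instance ..
end

instantiation bool :: enc
begin
definition "to_tree b = (if b then Node Leaf Leaf else Leaf)"
instance ..
end

text \<open>The trees are those of pairs of truth values, so that letters can later be inspected
  through \<open>letter_bits\<close> without any computation.\<close>

instantiation letter :: enc
begin
fun to_tree_letter where
  "to_tree_letter (Digit b) = Node Leaf (to_tree b)"
| "to_tree_letter Comma = Node (to_tree True) (to_tree False)"
| "to_tree_letter Semi = Node (to_tree True) (to_tree True)"
instance ..
end

section \<open>Sizes of codes and polynomial bounds\<close>

lemma esize_Pair [simp]: "esize (x, y) = 1 + esize x + esize y"
  by (simp add: esize_def to_tree_prod_def)

lemma esize_list [simp]: "esize [] = 1" "esize (x # xs) = 1 + esize x + esize xs"
  by (simp_all add: esize_def)

lemma esize_bool: "esize (b :: bool) \<le> 3"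
  by (simp add: esize_def to_tree_bool_def)

lemma esize_letter: "esize (a :: letter) \<le> 7"
  by (cases a) (simp_all add: esize_def to_tree_bool_def)

text \<open>Coefficients in the naturals are never negative. Monotonicity is what allows a size to
  be replaced by an upper bound inside a polynomial.\<close>

lemma poly_nat_mono: "m \<le> n \<Longrightarrow> poly p m \<le> poly (p :: nat poly) n"
  by (induction p) (auto intro: add_mono mult_mono)

definition poly_bounded :: "('a::enc \<Rightarrow> nat) \<Rightarrow> bool" where
  "poly_bounded h \<longleftrightarrow> (\<exists>p. \<forall>x. h x \<le> poly p (esize x))"

lemma poly_bounded_mono: "poly_bounded h \<Longrightarrow> (\<And>x. g x \<le> h x) \<Longrightarrow> poly_bounded g"
  unfolding poly_bounded_def using le_trans by blast

lemma poly_bounded_const: "poly_bounded (\<lambda>_. n)"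
  unfolding poly_bounded_def by (intro exI[of _ "[:n:]"]) simp

lemma poly_bounded_esize: "poly_bounded esize"
  unfolding poly_bounded_def by (intro exI[of _ "[:0, 1:]"]) simp

lemma poly_bounded_add: "poly_bounded g \<Longrightarrow> poly_bounded h \<Longrightarrow> poly_bounded (\<lambda>x. g x + h x)"
  unfolding poly_bounded_def by (metis add_mono poly_add)

lemma poly_bounded_mult: "poly_bounded g \<Longrightarrow> poly_bounded h \<Longrightarrow> poly_bounded (\<lambda>x. g x * h x)"
  unfolding poly_bounded_def by (metis mult_le_mono poly_mult)

lemma poly_bounded_poly: "poly_bounded h \<Longrightarrow> poly_bounded (\<lambda>x. poly p (h x))"
  unfolding poly_bounded_def by (metis poly_nat_mono poly_pcompose)

lemma poly_bounded_comp: "poly_bounded h \<Longrightarrow> poly_bounded (\<lambda>x. esize (f x)) \<Longrightarrow> poly_bounded (\<lambda>x. h (f x))"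
  by (metis (no_types, lifting) poly_bounded_def poly_bounded_mono poly_bounded_poly)

lemmas poly_bounded_intros = poly_bounded_const poly_bounded_esize poly_bounded_add poly_bounded_mult poly_bounded_poly

text \<open>The program \<open>c b\<close> works in place on register \<open>b\<close>, with the empty registers \<open>b + 1, \<dots>, b + N - 1\<close>
  as scratch space; the base \<open>b\<close> is a parameter so that programs can be nested without renaming.\<close>

definition computes :: "(nat \<Rightarrow> com) \<Rightarrow> nat \<Rightarrow> ('a::enc \<Rightarrow> nat) \<Rightarrow> ('a \<Rightarrow> 'b::enc) \<Rightarrow> bool" where
  "computes c N h f \<longleftrightarrow>
     (\<forall>b. regs (c b) \<le> b + N) \<and>
     (\<forall>b x s. s b = encode x \<longrightarrow> (\<forall>i. b < i \<longrightarrow> i < b + N \<longrightarrow> s i = []) \<longrightarrow>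
        run (c b) (h x) s (s(b := encode (f x))))"

text \<open>Composition needs the size of the intermediate result, so a polynomial bound on the
  output is carried along with the time bound.\<close>

definition ptime :: "('a::enc \<Rightarrow> 'b::enc) \<Rightarrow> bool" where
  "ptime f \<longleftrightarrow> poly_bounded (\<lambda>x. esize (f x)) \<and> (\<exists>c N h. poly_bounded h \<and> computes c N h f)"

lemma computes_weaken: "computes c N h f \<Longrightarrow> N \<le> N' \<Longrightarrow> computes c N' h f"
  unfolding computes_def by (meson add_le_mono le_trans less_le_trans nat_add_left_cancel_le order_refl)

lemma computesD:
  assumes "computes c N h f" "s b = encode x" "\<And>i. b < i \<Longrightarrow> i < b + N \<Longrightarrow> s i = []"
  shows "run (c b) (h x) s (s(b := encode (f x)))"
  using assms unfolding computes_def by blast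

lemma computes_regs: "computes c N h f \<Longrightarrow> regs (c b) \<le> b + N"
  unfolding computes_def by blast

lemma computesI:
  assumes "\<And>b. regs (c b) \<le> b + N"
    and "\<And>b x s. s b = encode x \<Longrightarrow> (\<And>i. b < i \<Longrightarrow> i < b + N \<Longrightarrow> s i = []) \<Longrightarrow>
      run (c b) (h x) s (s(b := encode (f x)))"
  shows "computes c N h f"
  using assms unfolding computes_def by blast

lemma ptimeI: "poly_bounded (\<lambda>x. esize (f x)) \<Longrightarrow> poly_bounded h \<Longrightarrow> computes c N h f \<Longrightarrow> ptime f"
  unfolding ptime_def by blast

lemma ptime_pb: "ptime f \<Longrightarrow> poly_bounded (\<lambda>x. esize (f x))"
  unfolding ptime_def by blast

lemma ptimeE:
  assumes "ptime f"
  obtains c N h where "poly_bounded h" "\<And>N'. N \<le> N' \<Longrightarrow> computes c N' h f"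
  using assms computes_weaken unfolding ptime_def by blast

section \<open>Closure properties\<close>

lemma ptime_id: "ptime (\<lambda>x. x)"
proof (rule ptimeI)
  show "computes (\<lambda>_. Skip) 0 (\<lambda>_. 1) (\<lambda>x :: 'a. x)"
    by (rule computesI) (use run_Skip in \<open>simp_all add: fun_upd_idem\<close>)
qed (intro poly_bounded_intros)+

text \<open>Programs see only codes, so changing the type while keeping the tree costs nothing. Thus
  a list cell is a pair, a number is its list of bits, and a truth value is a list with at most one
  entry.\<close>

lemma ptime_retype:
  assumes "ptime g" "\<And>x. to_tree (f x) = to_tree (g x)"
  shows "ptime f"
  using assms unfolding ptime_def computes_def esize_def by simp

lemma ptime_comp:
  fixes f :: "'a::enc \<Rightarrow> 'b::enc" and g :: "'b \<Rightarrow> 'c::enc"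
  assumes "ptime f" "ptime g"
  shows "ptime (\<lambda>x. g (f x))"
proof -
  obtain cf Nf hf where hf: "poly_bounded hf" and f: "\<And>N'. Nf \<le> N' \<Longrightarrow> computes cf N' hf f"
    using assms(1) by (rule ptimeE) blast
  obtain cg Ng hg where hg: "poly_bounded hg" and g: "\<And>N'. Ng \<le> N' \<Longrightarrow> computes cg N' hg g"
    using assms(2) by (rule ptimeE) blast
  let ?N = "Nf + Ng"
  note f = f[of ?N, simplified] and g = g[of ?N, simplified]
  show ?thesis
  proof (rule ptimeI)
    show "poly_bounded (\<lambda>x. esize (g (f x)))"
      using poly_bounded_comp[OF ptime_pb[OF assms(2)] ptime_pb[OF assms(1)]] .
    show "poly_bounded (\<lambda>x. 1 + hf x + hg (f x))"
      by (intro poly_bounded_intros hf poly_bounded_comp[OF hg] ptime_pb[OF assms(1)])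
    show "computes (\<lambda>b. cf b ;; cg b) ?N (\<lambda>x. 1 + hf x + hg (f x)) (\<lambda>x. g (f x))"
    proof (rule computesI)
      show "regs (cf b ;; cg b) \<le> b + ?N" for b
        using computes_regs[OF f, of b] computes_regs[OF g, of b] by simp
      fix b and x :: 'a and s :: store
      assume s: "s b = encode x" "\<And>i. b < i \<Longrightarrow> i < b + ?N \<Longrightarrow> s i = []"
      have "run (cg b) (hg (f x)) (s(b := encode (f x))) (s(b := encode (g (f x))))"
        using computesD[OF g, of "s(b := encode (f x))" b "f x"] s(2) by simp
      then show "run (cf b ;; cg b) (1 + hf x + hg (f x)) s (s(b := encode (g (f x))))"
        using run_Seq computesD[OF f, of s b, OF s] by blast
    qed
  qed
qed

lemma ptime_const: "ptime (\<lambda>_. c)"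
proof (rule ptimeI)
  show "poly_bounded (\<lambda>x :: 'a. 1 + (2 * esize x + 1) + (3 * length (encode c) + 1))"
    by (intro poly_bounded_intros)
  show "computes (\<lambda>b. clear b ;; pushes b (encode c)) 1
      (\<lambda>x :: 'a. 1 + (2 * esize x + 1) + (3 * length (encode c) + 1)) (\<lambda>_. c)"
  proof (rule computesI)
    show "regs (clear b ;; pushes b (encode c)) \<le> b + 1" for b
      by (simp add: clear_def regs_pushes)
    fix b and x :: 'a and s :: store
    assume s: "s b = encode x"
    have "run (clear b) (2 * esize x + 1) s (s(b := []))"
      using run_clear[of b s] s by (simp add: esize_def)
    from run_Seq[OF this run_pushes[of b "encode c"]]
    show "run (clear b ;; pushes b (encode c)) (1 + (2 * esize x + 1) + (3 * length (encode c) + 1))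
        s (s(b := encode c))" by simp
  qed
qed (intro poly_bounded_intros)

lemma ptime_Pair:
  fixes f :: "'a::enc \<Rightarrow> 'b::enc" and g :: "'a \<Rightarrow> 'c::enc"
  assumes "ptime f" "ptime g"
  shows "ptime (\<lambda>x. (f x, g x))"
proof -
  obtain cf Nf hf where hf: "poly_bounded hf" and f: "\<And>N'. Nf \<le> N' \<Longrightarrow> computes cf N' hf f"
    using assms(1) by (rule ptimeE) blast
  obtain cg Ng hg where hg: "poly_bounded hg" and g: "\<And>N'. Ng \<le> N' \<Longrightarrow> computes cg N' hg g"
    using assms(2) by (rule ptimeE) blast
  define N where "N = Nf + Ng + 1"
  have f: "computes cf N hf f" and g: "computes cg N hg g"
    using f g by (simp_all add: N_def)
  \<comment> \<open>The argument is needed twice. Both \<open>move\<close> and \<open>copy\<close>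
    reverse, so passing through the transfer register \<open>b + 2 * N\<close> leaves two upright
    copies in \<open>b\<close> and \<open>b + N\<close>. Each component then runs in its own block
    of \<open>N\<close> registers, and the first result is stacked on the second, again by two
    reversals.\<close>
  define c where "c b = move b (b + 2 * N) ;; copy (b + 2 * N) b (b + N) ;; cg b ;; cf (b + N) ;;
    move (b + N) (b + 2 * N) ;; move (b + 2 * N) b ;; Push b (Digit True)" for b
  define h where "h x = 6 + (8 * esize x + 1) + (11 * esize x + 1) + hg x + hf x +
    (8 * esize (f x) + 1) + (8 * esize (f x) + 1) + 2" for x
  show ?thesis
  proof (rule ptimeI)
    show "poly_bounded (\<lambda>x. esize (f x, g x))"
      unfolding esize_Pair by (intro poly_bounded_intros ptime_pb assms)
    show "poly_bounded h"
      unfolding h_def by (intro poly_bounded_intros ptime_pb assms hf hg)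
    show "computes c (2 * N + 1) h (\<lambda>x. (f x, g x))"
    proof (rule computesI)
      show "regs (c b) \<le> b + (2 * N + 1)" for b
        using computes_regs[OF f, of "b + N"] computes_regs[OF g, of b]
        by (auto simp: c_def move_def copy_def intro!: regs_transfer)
      fix b and x :: 'a and s :: store
      assume s: "s b = encode x" "\<And>i. b < i \<Longrightarrow> i < b + (2 * N + 1) \<Longrightarrow> s i = []"
      have N: "N > 0" by (simp add: N_def)
      let ?T = "b + 2 * N" and ?K = "b + N"
      have 1: "run (move b ?T) (8 * esize x + 1) s (s(b := [], ?T := rev (encode x)))"
        using run_move[of b ?T s] s N by (simp add: esize_def)
      have 2: "run (copy ?T b ?K) (11 * esize x + 1) (s(b := [], ?T := rev (encode x)))
          (s(?K := encode x))"
        by (rule run_conv[OF run_copy[of ?T b ?K "s(b := [], ?T := rev (encode x))"]])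
          (use s N in \<open>auto simp: fun_eq_iff esize_def\<close>)
      have 3: "run (cg b) (hg x) (s(?K := encode x)) (s(?K := encode x, b := encode (g x)))"
        by (rule computesD[OF g]) (use s N in auto)
      have 4: "run (cf ?K) (hf x) (s(?K := encode x, b := encode (g x)))
          (s(b := encode (g x), ?K := encode (f x)))"
        using computesD[OF f, of "s(?K := encode x, b := encode (g x))" ?K x] s N
        by (simp add: fun_upd_twist)
      have 5: "run (move ?K ?T) (8 * esize (f x) + 1) (s(b := encode (g x), ?K := encode (f x)))
          (s(b := encode (g x), ?T := rev (encode (f x))))"
        by (rule run_conv[OF run_move[of ?K ?T "s(b := encode (g x), ?K := encode (f x))"]])
          (use s N in \<open>auto simp: fun_eq_iff esize_def\<close>)
      have 6: "run (move ?T b) (8 * esize (f x) + 1) (s(b := encode (g x), ?T := rev (encode (f x))))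
          (s(b := encode (f x) @ encode (g x)))"
        by (rule run_conv[OF run_move[of ?T b "s(b := encode (g x), ?T := rev (encode (f x)))"]])
          (use s N in \<open>auto simp: fun_eq_iff esize_def\<close>)
      have 7: "run (Push b (Digit True)) 2 (s(b := encode (f x) @ encode (g x)))
          (s(b := encode (f x, g x)))"
        using run_Push[of b "Digit True" "s(b := encode (f x) @ encode (g x))"]
        by (simp add: to_tree_prod_def)
      show "run (c b) (h x) s (s(b := encode (f x, g x)))"
        unfolding c_def
        by (rule run_mono[OF run_Seq[OF 1 run_Seq[OF 2 run_Seq[OF 3 run_Seq[OF 4
            run_Seq[OF 5 run_Seq[OF 6 7]]]]]]]) (simp add: h_def)
    qed
  qed
qed

text \<open>Register \<open>b + 1\<close> counts, in unary, the subtrees that are still to be read.\<close>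

definition split_loop :: "nat \<Rightarrow> com" where
  "split_loop b = While (b + 1) (\<lambda>x. x \<noteq> None)
     (If b (\<lambda>x. x = Some (Digit True)) (Push (b + 1) (Digit True) ;; Push (b + 2) (Digit True))
        (Pop (b + 1) ;; Push (b + 2) (Digit False)) ;; Pop b)"

text \<open>The rest of the loop enters as a hypothesis: reading one subtree uses up one mark of the
  counter and reaches a state from which the rest takes time \<open>U\<close>. In this form a
  \<open>Node\<close> is handled by reading its two subtrees in turn. A round on
  \<open>Digit True\<close> takes 9 steps.\<close>

lemma run_split_loop:
  assumes "run (split_loop b) U (s(b := w, b + 1 := v, b + 2 := rev (code a) @ s (b + 2))) s'"
    and "s b = code a @ w" "s (b + 1) = Digit True # v"
  shows "run (split_loop b) (9 * length (code a) + U) s s'"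
  using assms
proof (induction a arbitrary: s w v U)
  case Leaf
  let ?s1 = "s(b + 1 := v, b + 2 := Digit False # s (b + 2))"
  have 1: "run (If b (\<lambda>x. x = Some (Digit True)) (Push (b + 1) (Digit True) ;; Push (b + 2) (Digit True))
        (Pop (b + 1) ;; Push (b + 2) (Digit False))) (1 + (1 + 1 + 2)) s ?s1"
    using run_Seq[OF run_Pop[of "b + 1" s] run_Push[of "b + 2" "Digit False"]] Leaf.prems(2,3)
    by (intro run_If) auto
  have 2: "run (Pop b) 1 ?s1 (s(b := w, b + 1 := v, b + 2 := Digit False # s (b + 2)))"
    using run_Pop[of b ?s1] Leaf.prems(2) by (simp add: fun_upd_twist)
  have "run (split_loop b) (1 + (1 + (1 + (1 + 1 + 2)) + 1) + U) s s'"
    unfolding split_loop_def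
    by (rule run_WhileTrue[OF _ run_Seq[OF 1 2]])
      (use Leaf.prems in \<open>simp_all add: split_loop_def fun_upd_def\<close>)
  then show ?case by (rule run_mono) simp
next
  case (Node a1 a2)
  let ?s1 = "s(b + 1 := Digit True # Digit True # v, b + 2 := Digit True # s (b + 2))"
  let ?s2 = "s(b := code a1 @ code a2 @ w, b + 1 := Digit True # Digit True # v,
    b + 2 := Digit True # s (b + 2))"
  let ?s3 = "s(b := code a2 @ w, b + 1 := Digit True # v,
    b + 2 := rev (code a1) @ Digit True # s (b + 2))"
  have 1: "run (If b (\<lambda>x. x = Some (Digit True)) (Push (b + 1) (Digit True) ;; Push (b + 2) (Digit True))
        (Pop (b + 1) ;; Push (b + 2) (Digit False))) (1 + (1 + 2 + 2)) s ?s1"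
    using run_Seq[OF run_Push[of "b + 1" "Digit True" s] run_Push[of "b + 2" "Digit True"]]
      Node.prems(2,3)
    by (intro run_If) auto
  have 2: "run (Pop b) 1 ?s1 ?s2"
    using run_Pop[of b ?s1] Node.prems(2) by (simp add: fun_upd_twist)
  have 3: "run (split_loop b) (9 * length (code a2) + U) ?s3 s'"
  proof (rule Node.IH(2)[where w = w and v = v])
    have eq: "?s3(b := w, b + 1 := v, b + 2 := rev (code a2) @ ?s3 (b + 2)) =
        s(b := w, b + 1 := v, b + 2 := rev (code (Node a1 a2)) @ s (b + 2))"
      by (auto simp: fun_eq_iff)
    show "run (split_loop b) U (?s3(b := w, b + 1 := v, b + 2 := rev (code a2) @ ?s3 (b + 2))) s'"
      unfolding eq by (rule Node.prems(1))
  qed simp_all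
  have 4: "run (split_loop b) (9 * length (code a1) + (9 * length (code a2) + U)) ?s2 s'"
  proof (rule Node.IH(1)[where w = "code a2 @ w" and v = "Digit True # v"])
    have eq: "?s2(b := code a2 @ w, b + 1 := Digit True # v, b + 2 := rev (code a1) @ ?s2 (b + 2)) = ?s3"
      by (auto simp: fun_eq_iff)
    show "run (split_loop b) (9 * length (code a2) + U)
        (?s2(b := code a2 @ w, b + 1 := Digit True # v, b + 2 := rev (code a1) @ ?s2 (b + 2))) s'"
      unfolding eq by (rule 3)
  qed simp_all
  have "run (split_loop b) (1 + (1 + (1 + (1 + 2 + 2)) + 1) +
      (9 * length (code a1) + (9 * length (code a2) + U))) s s'"
    unfolding split_loop_def
    by (rule run_WhileTrue[OF _ run_Seq[OF 1 2]])
      (use 4 Node.prems(3) in \<open>simp_all add: split_loop_def\<close>)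
  then show ?case by (rule run_mono) simp
qed

definition split_pair :: "nat \<Rightarrow> com" where
  "split_pair b = Pop b ;; Push (b + 1) (Digit True) ;; split_loop b"

lemma regs_split_pair: "regs (split_pair b) = b + 3"
  by (simp add: split_pair_def split_loop_def)

lemma run_split_pair:
  assumes "s b = code (Node t u)" "s (b + 1) = []" "s (b + 2) = []"
  shows "run (split_pair b) (6 + 9 * length (code t)) s (s(b := code u, b + 2 := rev (code t)))"
proof -
  let ?s = "s(b := code t @ code u, b + 1 := [Digit True])"
  have 1: "run (Pop b) 1 s (s(b := code t @ code u))"
    using run_Pop[of b s] assms by simp
  have 2: "run (Push (b + 1) (Digit True)) 2 (s(b := code t @ code u)) ?s"
    using run_Push[of "b + 1" "Digit True" "s(b := code t @ code u)"] assms by simp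
  have "run (split_loop b) 1 (s(b := code u, b + 2 := rev (code t))) (s(b := code u, b + 2 := rev (code t)))"
    unfolding split_loop_def by (rule run_WhileFalse) (use assms in simp)
  then have 3: "run (split_loop b) (9 * length (code t) + 1) ?s (s(b := code u, b + 2 := rev (code t)))"
    using assms by (intro run_split_loop[where w = "code u" and v = "[]"])
      (simp_all add: fun_upd_idem fun_upd_twist[of _ "Suc b"])
  show ?thesis
    unfolding split_pair_def by (rule run_mono, rule run_Seq[OF 1 run_Seq[OF 2 3]]) simp
qed

lemma ptime_fst0: "ptime (fst :: 'a::enc \<times> 'b::enc \<Rightarrow> 'a)"
proof (rule ptimeI)
  show "poly_bounded (\<lambda>x :: 'a \<times> 'b. esize (fst x))"
    by (rule poly_bounded_mono[OF poly_bounded_esize]) (auto simp: esize_def to_tree_prod_def)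
  show "poly_bounded (\<lambda>x :: 'a \<times> 'b. 30 * esize x + 10)"
    by (intro poly_bounded_intros)
  show "computes (\<lambda>b. split_pair b ;; clear b ;; move (b + 2) b) 3
      (\<lambda>x :: 'a \<times> 'b. 30 * esize x + 10) fst"
  proof (rule computesI)
    show "regs (split_pair b ;; clear b ;; move (b + 2) b) \<le> b + 3" for b
      by (auto simp: regs_split_pair clear_def move_def intro!: regs_transfer)
    fix b and x :: "'a \<times> 'b" and s :: store
    assume s: "s b = encode x" "\<And>i. b < i \<Longrightarrow> i < b + 3 \<Longrightarrow> s i = []"
    have s': "s (b + 1) = []" "s (b + 2) = []" using s(2) by simp_all
    let ?t = "encode (fst x)" and ?u = "encode (snd x)"
    have 1: "run (split_pair b) (6 + 9 * length ?t) s (s(b := ?u, b + 2 := rev ?t))"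
      using s s' by (intro run_split_pair) (simp_all add: to_tree_prod_def)
    have 2: "run (clear b) (2 * length ?u + 1) (s(b := ?u, b + 2 := rev ?t))
        (s(b := [], b + 2 := rev ?t))"
      using run_clear[of b "s(b := ?u, b + 2 := rev ?t)"] by (simp add: fun_upd_twist)
    have 3: "run (move (b + 2) b) (8 * length ?t + 1) (s(b := [], b + 2 := rev ?t)) (s(b := ?t))"
      by (rule run_conv[OF run_move[of "b + 2" b "s(b := [], b + 2 := rev ?t)"]])
        (use s' in \<open>auto simp: fun_eq_iff esize_def\<close>)
    have "esize x = 1 + length ?t + length ?u"
      by (simp add: esize_def to_tree_prod_def)
    then show "run (split_pair b ;; clear b ;; move (b + 2) b) (30 * esize x + 10) s (s(b := ?t))"
      by (intro run_mono[OF run_Seq[OF 1 run_Seq[OF 2 3]]]) simp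
  qed
qed

lemma ptime_snd0: "ptime (snd :: 'a::enc \<times> 'b::enc \<Rightarrow> 'b)"
proof (rule ptimeI)
  show "poly_bounded (\<lambda>x :: 'a \<times> 'b. esize (snd x))"
    by (rule poly_bounded_mono[OF poly_bounded_esize]) (auto simp: esize_def to_tree_prod_def)
  show "poly_bounded (\<lambda>x :: 'a \<times> 'b. 30 * esize x + 10)"
    by (intro poly_bounded_intros)
  show "computes (\<lambda>b. split_pair b ;; clear (b + 2)) 3 (\<lambda>x :: 'a \<times> 'b. 30 * esize x + 10) snd"
  proof (rule computesI)
    show "regs (split_pair b ;; clear (b + 2)) \<le> b + 3" for b
      by (auto simp: regs_split_pair clear_def)
    fix b and x :: "'a \<times> 'b" and s :: store
    assume s: "s b = encode x" "\<And>i. b < i \<Longrightarrow> i < b + 3 \<Longrightarrow> s i = []"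
    have s': "s (b + 1) = []" "s (b + 2) = []" using s(2) by simp_all
    let ?t = "encode (fst x)" and ?u = "encode (snd x)"
    have 1: "run (split_pair b) (6 + 9 * length ?t) s (s(b := ?u, b + 2 := rev ?t))"
      using s s' by (intro run_split_pair) (simp_all add: to_tree_prod_def)
    have 2: "run (clear (b + 2)) (2 * length ?t + 1) (s(b := ?u, b + 2 := rev ?t)) (s(b := ?u))"
      by (rule run_conv[OF run_clear[of "b + 2" "s(b := ?u, b + 2 := rev ?t)"]])
        (use s' in \<open>auto simp: fun_eq_iff esize_def\<close>)
    have "esize x = 1 + length ?t + length ?u"
      by (simp add: esize_def to_tree_prod_def)
    then show "run (split_pair b ;; clear (b + 2)) (30 * esize x + 10) s (s(b := ?u))"
      by (intro run_mono[OF run_Seq[OF 1 2]]) simp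
  qed
qed

lemma ptime_case_list0:
  fixes f :: "'x::enc \<Rightarrow> 'b::enc" and g :: "('a::enc \<times> 'a list) \<times> 'x \<Rightarrow> 'b"
  assumes "ptime f" "ptime g"
  shows "ptime (\<lambda>p. case fst p of [] \<Rightarrow> f (snd p) | y # ys \<Rightarrow> g ((y, ys), snd p))"
proof -
  obtain cf Nf hf where hf: "poly_bounded hf" and f: "\<And>N'. Nf \<le> N' \<Longrightarrow> computes cf N' hf f"
    using assms(1) by (rule ptimeE) blast
  obtain cg Ng hg where hg: "poly_bounded hg" and g: "\<And>N'. Ng \<le> N' \<Longrightarrow> computes cg N' hg g"
    using assms(2) by (rule ptimeE) blast
  define N where "N = Nf + Ng + 1"
  have f: "computes cf N hf f" and g: "computes cg N hg g"
    using f g by (simp_all add: N_def)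
  obtain pf where pf: "\<And>x. hf x \<le> poly pf (esize x)"
    using hf unfolding poly_bounded_def by blast
  obtain pg where pg: "\<And>x. hg x \<le> poly pg (esize x)"
    using hg unfolding poly_bounded_def by blast
  obtain qf where qf: "\<And>x. esize (f x) \<le> poly qf (esize x)"
    using ptime_pb[OF assms(1)] unfolding poly_bounded_def by blast
  obtain qg where qg: "\<And>x. esize (g x) \<le> poly qg (esize x)"
    using ptime_pb[OF assms(2)] unfolding poly_bounded_def by blast
  let ?F = "\<lambda>p. case fst p of [] \<Rightarrow> f (snd p) | y # ys \<Rightarrow> g ((y, ys), snd p)"
  \<comment> \<open>Once the leading letter of the pair is removed, the top letter tells whether the
    list is empty. If so, dropping it leaves the code of the second component. Otherwise the pushed
    letter restores the input, which is also the code required by \<open>g\<close>, since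
    \<open>y # ys\<close> and \<open>(y, ys)\<close> have the same tree.\<close>
  define c where "c b = Pop b ;; If b (\<lambda>x. x = Some (Digit True)) (Push b (Digit True) ;; cg b)
    (Pop b ;; cf b)" for b
  define h where "h x = 6 + poly pf (esize x) + poly pg (esize x)" for x :: "'a list \<times> 'x"
  show ?thesis
  proof (rule ptimeI)
    show "poly_bounded (\<lambda>p. esize (?F p))"
    proof (rule poly_bounded_mono)
      show "poly_bounded (\<lambda>p :: 'a list \<times> 'x. poly qf (esize p) + poly qg (esize p))"
        by (intro poly_bounded_intros)
      fix p :: "'a list \<times> 'x"
      show "esize (?F p) \<le> poly qf (esize p) + poly qg (esize p)"
      proof (cases p; cases "fst p")
        fix xs x assume "p = (xs, x)" "fst p = []"
        then show ?thesis
          using qf[of x] poly_nat_mono[of "esize x" "esize p" qf] by simp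
      next
        fix xs x y ys assume "p = (xs, x)" "fst p = y # ys"
        then show ?thesis
          using qg[of "((y, ys), x)"] by simp
      qed
    qed
    show "poly_bounded h" unfolding h_def by (intro poly_bounded_intros)
    show "computes c N h ?F"
    proof (rule computesI)
      show "regs (c b) \<le> b + N" for b
        using computes_regs[OF f, of b] computes_regs[OF g, of b] by (auto simp: c_def N_def)
      fix b and p :: "'a list \<times> 'x" and s :: store
      assume s: "s b = encode p" "\<And>i. b < i \<Longrightarrow> i < b + N \<Longrightarrow> s i = []"
      obtain xs x where p: "p = (xs, x)" by (cases p)
      have 1: "run (Pop b) 1 s (s(b := encode xs @ encode x))"
        using run_Pop[of b s] s p by (simp add: to_tree_prod_def)
      show "run (c b) (h p) s (s(b := encode (?F p)))"
      proof (cases xs)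
        case Nil
        have 2: "run (Pop b) 1 (s(b := encode xs @ encode x)) (s(b := encode x))"
          using run_Pop[of b "s(b := encode xs @ encode x)"] Nil by simp
        have 3: "run (cf b) (hf x) (s(b := encode x)) (s(b := encode (?F p)))"
          using computesD[OF f, of "s(b := encode x)" b x] s(2) p Nil by simp
        have 4: "run (If b (\<lambda>x. x = Some (Digit True)) (Push b (Digit True) ;; cg b) (Pop b ;; cf b))
            (1 + (1 + 1 + hf x)) (s(b := encode xs @ encode x)) (s(b := encode (?F p)))"
          using Nil by (intro run_If run_Seq[OF 2 3]) simp
        have "hf x \<le> poly pf (esize p)"
          using pf[of x] poly_nat_mono[of "esize x" "esize p" pf] p by simp
        then show ?thesis
          unfolding c_def by (intro run_mono[OF run_Seq[OF 1 4]]) (simp add: h_def)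
      next
        case (Cons y ys)
        have 2: "run (Push b (Digit True)) 2 (s(b := encode xs @ encode x)) s"
          using run_Push[of b "Digit True" "s(b := encode xs @ encode x)"] s p
          by (simp add: to_tree_prod_def fun_upd_idem)
        have 3: "run (cg b) (hg ((y, ys), x)) s (s(b := encode (?F p)))"
          using computesD[OF g, of s b "((y, ys), x)"] s p Cons by (simp add: to_tree_prod_def)
        have 4: "run (If b (\<lambda>x. x = Some (Digit True)) (Push b (Digit True) ;; cg b) (Pop b ;; cf b))
            (1 + (1 + 2 + hg ((y, ys), x))) (s(b := encode xs @ encode x)) (s(b := encode (?F p)))"
          using Cons by (intro run_If run_Seq[OF 2 3]) simp
        have "hg ((y, ys), x) \<le> poly pg (esize p)"
          using pg[of "((y, ys), x)"] p Cons by simp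
        then show ?thesis
          unfolding c_def by (intro run_mono[OF run_Seq[OF 1 4]]) (simp add: h_def)
      qed
    qed
  qed
qed

text \<open>The list in the first component controls the loop, which stops when it is empty.
  \<open>B\<close> bounds both the number of rounds and the sizes of all states, so that every round
  takes time polynomial in \<open>B x\<close>.\<close>

lemma ptime_iterate:
  fixes G :: "'a::enc list \<times> 's::enc \<Rightarrow> 'a list \<times> 's" and I :: "'x::enc \<Rightarrow> 'a list \<times> 's"
  assumes "ptime G" "ptime I" "poly_bounded B"
    and iter: "\<And>x. \<exists>n \<le> B x. fst ((G ^^ n) (I x)) = [] \<and> (\<forall>i<n. fst ((G ^^ i) (I x)) \<noteq> []) \<and>
      (\<forall>i\<le>n. esize ((G ^^ i) (I x)) \<le> B x) \<and> (G ^^ n) (I x) = R x"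
  shows "ptime R"
proof -
  obtain cI NI hI where hI: "poly_bounded hI" and I: "\<And>N'. NI \<le> N' \<Longrightarrow> computes cI N' hI I"
    using assms(2) by (rule ptimeE) blast
  obtain cG NG hG where hG: "poly_bounded hG" and G: "\<And>N'. NG \<le> N' \<Longrightarrow> computes cG N' hG G"
    using assms(1) by (rule ptimeE) blast
  define N where "N = NI + NG + 1"
  have I: "computes cI N hI I" and G: "computes cG N hG G"
    using I G by (simp_all add: N_def)
  obtain p where p: "\<And>x. hG x \<le> poly p (esize x)"
    using hG unfolding poly_bounded_def by blast
  \<comment> \<open>Between rounds the leading letter of the pair is missing, so that the top letter
    shows whether the list is empty.\<close>
  define loop where
    "loop b = While b (\<lambda>x. x = Some (Digit True)) (Push b (Digit True) ;; cG b ;; Pop b)" for b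
  have run_loop: "run (loop b) (n * (M + 6) + 1) (s(b := tl (encode z)))
      (s(b := tl (encode ((G ^^ n) z))))"
    if s: "\<And>i. b < i \<Longrightarrow> i < b + N \<Longrightarrow> s i = []"
      and "fst ((G ^^ n) z) = []" "\<forall>i<n. fst ((G ^^ i) z) \<noteq> []" "\<forall>i<n. hG ((G ^^ i) z) \<le> M"
    for b n M z and s :: store
    using that(2-)
  proof (induction n arbitrary: z)
    case 0
    have "run (loop b) 1 (s(b := tl (encode z))) (s(b := tl (encode z)))"
      unfolding loop_def by (rule run_WhileFalse) (use 0 in \<open>simp add: to_tree_prod_def\<close>)
    then show ?case by (rule run_conv) (simp_all add: fun_upd_def)
  next
    case (Suc n)
    have z: "fst z \<noteq> []" using Suc.prems(2)[rule_format, of 0] by simp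
    then obtain y ys where y: "fst z = y # ys" by (cases "fst z") auto
    have 1: "run (Push b (Digit True)) 2 (s(b := tl (encode z))) (s(b := encode z))"
      using run_Push[of b "Digit True" "s(b := tl (encode z))"] by (simp add: to_tree_prod_def)
    have "run (cG b) (hG z) (s(b := encode z)) (s(b := encode (G z)))"
      using computesD[OF G, of "s(b := encode z)" b z] s by simp
    then have 2: "run (cG b) M (s(b := encode z)) (s(b := encode (G z)))"
      by (rule run_mono) (use Suc.prems(3)[rule_format, of 0] in simp)
    have 3: "run (Pop b) 1 (s(b := encode (G z))) (s(b := tl (encode (G z))))"
      using run_Pop[of b "s(b := encode (G z))"] by simp
    have 4: "run (loop b) (n * (M + 6) + 1) (s(b := tl (encode (G z))))
        (s(b := tl (encode ((G ^^ n) (G z)))))"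
    proof (rule Suc.IH)
      show "fst ((G ^^ n) (G z)) = []"
        using Suc.prems(1) by (simp add: funpow_swap1)
      show "\<forall>i<n. fst ((G ^^ i) (G z)) \<noteq> []" "\<forall>i<n. hG ((G ^^ i) (G z)) \<le> M"
        using Suc.prems(2,3)[rule_format, of "Suc _"] by (simp_all add: funpow_swap1)
    qed
    have "run (loop b) (1 + (1 + 2 + (1 + M + 1)) + (n * (M + 6) + 1)) (s(b := tl (encode z)))
        (s(b := tl (encode ((G ^^ n) (G z)))))"
      unfolding loop_def
      by (rule run_WhileTrue[OF _ run_Seq[OF 1 run_Seq[OF 2 3]] 4[unfolded loop_def]])
        (simp add: y to_tree_prod_def)
    then show ?case
      by (rule run_conv) (simp_all add: funpow_swap1 fun_eq_iff)
  qed
  define c where "c b = cI b ;; Pop b ;; loop b ;; Push b (Digit True)" for b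
  define h where "h x = 6 + hI x + (B x * (poly p (B x) + 6) + 1)" for x
  show ?thesis
  proof (rule ptimeI)
    show "poly_bounded (\<lambda>x. esize (R x))"
      by (rule poly_bounded_mono[OF assms(3)]) (use iter in \<open>metis order_refl\<close>)
    show "poly_bounded h"
      unfolding h_def by (intro poly_bounded_intros hI assms(3))
    show "computes c N h R"
    proof (rule computesI)
      show "regs (c b) \<le> b + N" for b
        using computes_regs[OF I, of b] computes_regs[OF G, of b]
        by (auto simp: c_def loop_def N_def)
      fix b and x :: 'x and s :: store
      assume s: "s b = encode x" "\<And>i. b < i \<Longrightarrow> i < b + N \<Longrightarrow> s i = []"
      obtain n where n: "n \<le> B x" "fst ((G ^^ n) (I x)) = []" "\<forall>i<n. fst ((G ^^ i) (I x)) \<noteq> []"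
        "\<forall>i\<le>n. esize ((G ^^ i) (I x)) \<le> B x" "(G ^^ n) (I x) = R x"
        using iter by blast
      have 1: "run (cI b) (hI x) s (s(b := encode (I x)))"
        using computesD[OF I, of s b x] s by blast
      have 2: "run (Pop b) 1 (s(b := encode (I x))) (s(b := tl (encode (I x))))"
        using run_Pop[of b "s(b := encode (I x))"] by simp
      have "hG ((G ^^ i) (I x)) \<le> poly p (B x)" if "i < n" for i
        using p[of "(G ^^ i) (I x)"] poly_nat_mono[of "esize ((G ^^ i) (I x))" "B x" p] n(4) that
        by (meson le_trans less_imp_le)
      then have "run (loop b) (n * (poly p (B x) + 6) + 1) (s(b := tl (encode (I x))))
          (s(b := tl (encode (R x))))"
        using run_loop[of b s n "I x" "poly p (B x)"] s(2) n(2,3,5) by simp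
      then have 3: "run (loop b) (B x * (poly p (B x) + 6) + 1) (s(b := tl (encode (I x))))
          (s(b := tl (encode (R x))))"
        by (rule run_mono) (use n(1) in simp)
      have 4: "run (Push b (Digit True)) 2 (s(b := tl (encode (R x)))) (s(b := encode (R x)))"
        using run_Push[of b "Digit True" "s(b := tl (encode (R x)))"] by (simp add: to_tree_prod_def)
      show "run (c b) (h x) s (s(b := encode (R x)))"
        unfolding c_def
        by (rule run_mono[OF run_Seq[OF 1 run_Seq[OF 2 run_Seq[OF 3 4]]]]) (simp add: h_def)
    qed
  qed
qed

lemma ptime_class_P:
  fixes D :: "letter list \<Rightarrow> bool"
  assumes "ptime D"
  shows "{w. D w} \<in> class_P"
proof -
  obtain c N h where h: "poly_bounded h" and c: "\<And>N'. N \<le> N' \<Longrightarrow> computes c N' h D"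
    using assms by (rule ptimeE) blast
  note c = c[of "N + 2", simplified]
  obtain p where p: "\<And>w. h w \<le> poly p (esize w)"
    using h unfolding poly_bounded_def by blast
  \<comment> \<open>The raw input word is not yet the code of a list of letters. The prefix reverses
    it and then builds that code from the last letter to the first, on top of the code of the empty
    list.\<close>
  define c' where "c' = move 0 1 ;; Push 0 (Digit False) ;;
    transfer 1 (\<lambda>a. pushes 0 (Digit True # encode a)) ;; c 0"
  define q where "q = [:40, 40:] + pcompose p [:1, 8:]"
  have esize_w: "esize w \<le> 8 * length w + 1" for w :: "letter list"
  proof (induction w)
    case (Cons a w)
    then show ?case using esize_letter[of a] by simp
  qed simp
  have "\<exists>t s. t \<le> poly q (length w) \<and> exec c' t ((\<lambda>_. [])(0 := w)) s \<and>
      (peek (s 0) = Some (Digit True) \<longleftrightarrow> w \<in> {w. D w})" for w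
  proof -
    let ?s = "(\<lambda>_. []) :: store"
    have 1: "run (move 0 1) (8 * length w + 1) (?s(0 := w)) (?s(1 := rev w))"
      using run_move[of 0 1 "?s(0 := w)"] by (simp add: fun_upd_twist fun_upd_idem)
    have 2: "run (Push 0 (Digit False)) 2 (?s(1 := rev w)) (?s(1 := rev w, 0 := [Digit False]))"
      using run_Push[of 0 "Digit False" "?s(1 := rev w)"] by simp
    define g :: "letter \<Rightarrow> store \<Rightarrow> store" where "g a s = s(0 := (Digit True # encode a) @ s 0)" for a s
    \<comment> \<open>The code of a list ends with the \<open>Digit False\<close> of the empty list;
      \<open>butlast\<close> removes just this terminator, which is already on the stack.\<close>
    have fold: "fold g (rev w) s = s(0 := butlast (encode w) @ s 0)" for s
    proof (induction w arbitrary: s)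
      case (Cons a w)
      have "encode w \<noteq> []" by (cases w) simp_all
      have "fold g (rev (a # w)) s = g a (s(0 := butlast (encode w) @ s 0))"
        using Cons.IH by (simp add: fun_upd_def)
      also have "\<dots> = s(0 := butlast (encode (a # w)) @ s 0)"
        using \<open>encode w \<noteq> []\<close> by (simp add: g_def butlast_append)
      finally show ?case .
    qed simp
    have last: "butlast (encode w) @ [Digit False] = encode w"
    proof (induction w)
      case (Cons a w)
      have "encode w \<noteq> []" by (cases w) simp_all
      with Cons show ?case by (simp add: butlast_append)
    qed simp
    have "run (transfer 1 (\<lambda>a. pushes 0 (Digit True # encode a)))
        ((25 + 6) * length ((?s(1 := rev w, 0 := [Digit False])) 1) + 1) (?s(1 := rev w, 0 := [Digit False]))
        ((fold g ((?s(1 := rev w, 0 := [Digit False])) 1) (?s(1 := rev w, 0 := [Digit False])))(1 := []))"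
    proof (rule run_transfer)
      fix a :: letter and s :: store
      have "3 * length (Digit True # encode a) + 1 \<le> 25"
        using esize_letter[of a] by (simp add: esize_def)
      then show "run (pushes 0 (Digit True # encode a)) 25 s (g a s)"
        unfolding g_def by (rule run_mono[OF run_pushes])
    qed (auto simp: g_def fun_upd_twist)
    then have 3: "run (transfer 1 (\<lambda>a. pushes 0 (Digit True # encode a))) (31 * length w + 1)
        (?s(1 := rev w, 0 := [Digit False])) (?s(0 := encode w))"
      by (rule run_conv) (use last in \<open>auto simp: fold fun_eq_iff\<close>)
    have 4: "run (c 0) (h w) (?s(0 := encode w)) (?s(0 := encode (D w)))"
      using computesD[OF c, of "?s(0 := encode w)" 0 w] by simp
    have "run c' (1 + (8 * length w + 1) + (1 + 2 + (1 + (31 * length w + 1) + h w)))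
        (?s(0 := w)) (?s(0 := encode (D w)))"
      unfolding c'_def by (intro run_Seq 1 2 3 4 run_Seq[OF 1 run_Seq[OF 2 run_Seq[OF 3 4]]])
    then obtain t where t: "t \<le> 1 + (8 * length w + 1) + (1 + 2 + (1 + (31 * length w + 1) + h w))"
      "exec c' t (?s(0 := w)) (?s(0 := encode (D w)))"
      unfolding run_def by blast
    have "h w \<le> poly p (8 * length w + 1)"
      using p[of w] poly_nat_mono[OF esize_w, of p w] by simp
    then have "t \<le> poly q (length w)"
      using t(1) by (simp add: q_def poly_pcompose algebra_simps)
    with t(2) show ?thesis
      by (intro exI[of _ t] exI[of _ "?s(0 := encode (D w))"]) (simp add: to_tree_bool_def)
  qed
  moreover have "regs c' \<le> N + 2"
    using computes_regs[OF c, of 0]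
    by (auto simp: c'_def move_def intro!: regs_transfer order_trans[OF regs_pushes])
  ultimately show ?thesis
    by (intro class_P_exec[of c' "N + 2" q]) auto
qed

section \<open>Polynomial-time functions on lists and numbers\<close>

lemma ptime_fst: "ptime f \<Longrightarrow> ptime (\<lambda>x. fst (f x))"
  by (rule ptime_comp[OF _ ptime_fst0])

lemma ptime_snd: "ptime f \<Longrightarrow> ptime (\<lambda>x. snd (f x))"
  by (rule ptime_comp[OF _ ptime_snd0])

lemma ptime_comp2: "ptime (\<lambda>p. h (fst p) (snd p)) \<Longrightarrow> ptime f \<Longrightarrow> ptime g \<Longrightarrow> ptime (\<lambda>x. h (f x) (g x))"
  using ptime_comp[OF ptime_Pair, of f g "\<lambda>p. h (fst p) (snd p)"] by simp

lemma ptime_Cons: "ptime f \<Longrightarrow> ptime g \<Longrightarrow> ptime (\<lambda>x. f x # g x)"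
  by (rule ptime_retype[OF ptime_Pair]) (simp_all add: to_tree_prod_def)

lemma ptime_case_list:
  assumes "ptime l" "ptime f" "ptime (\<lambda>p. g (snd p) (fst (fst p)) (snd (fst p)))"
  shows "ptime (\<lambda>x. case l x of [] \<Rightarrow> f x | y # ys \<Rightarrow> g x y ys)"
  using ptime_comp[OF ptime_Pair[OF assms(1) ptime_id] ptime_case_list0[OF assms(2,3)]]
  by (simp cong: list.case_cong)

lemma ptime_If:
  assumes "ptime b" "ptime f" "ptime g"
  shows "ptime (\<lambda>x. if b x then f x else g x)"
proof -
  have "ptime (\<lambda>x. if b x then [False] else [])"
    by (rule ptime_retype[OF assms(1)]) (simp add: to_tree_bool_def)
  from ptime_case_list[OF this assms(3) ptime_comp[OF ptime_snd[OF ptime_id] assms(2)]]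
  have "ptime (\<lambda>x. case (if b x then [False] else []) of [] \<Rightarrow> g x | _ # _ \<Rightarrow> f x)" .
  then show ?thesis by (rule back_subst[of ptime]) auto
qed

lemma ptime_not: "ptime b \<Longrightarrow> ptime (\<lambda>x. \<not> b x)"
  using ptime_If[OF _ ptime_const[of False] ptime_const[of True], of b] by (rule back_subst[of ptime]) auto

lemma ptime_conj: "ptime b \<Longrightarrow> ptime c \<Longrightarrow> ptime (\<lambda>x. b x \<and> c x)"
  using ptime_If[OF _ _ ptime_const[of False], of b c] by (rule back_subst[of ptime]) auto

lemma ptime_disj: "ptime b \<Longrightarrow> ptime c \<Longrightarrow> ptime (\<lambda>x. b x \<or> c x)"
  using ptime_If[OF _ ptime_const[of True], of b c] by (rule back_subst[of ptime]) auto

lemma ptime_iff: "ptime b \<Longrightarrow> ptime c \<Longrightarrow> ptime (\<lambda>x. b x \<longleftrightarrow> c x)"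
  using ptime_If[OF _ _ ptime_not, of b c c] by (rule back_subst[of ptime]) auto

lemmas ptime_basic = ptime_id ptime_const ptime_fst ptime_snd ptime_Pair ptime_Cons ptime_If ptime_not ptime_conj ptime_disj ptime_iff
  ptime_case_list

lemma ptime_tl: "ptime f \<Longrightarrow> ptime (\<lambda>x. tl (f x))"
proof -
  assume "ptime f"
  then have "ptime (\<lambda>x. case f x of [] \<Rightarrow> [] | y # ys \<Rightarrow> ys)"
    by (intro ptime_basic)
  then show ?thesis by (simp add: tl_def)
qed

lemma ptime_null: "ptime f \<Longrightarrow> ptime (\<lambda>x. f x = [])"
proof -
  assume "ptime f"
  then have "ptime (\<lambda>x. case f x of [] \<Rightarrow> True | y # ys \<Rightarrow> False)"
    by (intro ptime_basic)
  then show ?thesis by (rule back_subst[of ptime]) (auto simp: fun_eq_iff neq_Nil_conv split: list.split)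
qed

section \<open>Sizes of lists and bounded recursion\<close>

lemma esize_sum_list: "esize xs = 1 + sum_list (map (\<lambda>x. 1 + esize x) xs)"
  by (induction xs) simp_all

lemma esize_append: "esize (xs @ ys) + 1 = esize xs + esize ys"
  by (induction xs) simp_all

lemma esize_rev [simp]: "esize (rev xs) = esize xs"
  by (simp add: esize_sum_list flip: rev_map)

lemma length_less_esize: "length xs < esize xs"
  by (induction xs) simp_all

lemma esize_member: "x \<in> set xs \<Longrightarrow> esize x < esize xs"
  by (induction xs) auto

lemma esize_prefix:
  assumes "xs = ys @ zs"
  shows "esize ys \<le> esize xs" "esize zs \<le> esize xs"
  using esize_append[of ys zs] esize_pos[of ys] esize_pos[of zs] assms by simp_all

lemma esize_list_bound: "(\<And>x. x \<in> set xs \<Longrightarrow> esize x \<le> B) \<Longrightarrow> esize xs \<le> 1 + length xs * (1 + B)"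
proof (induction xs)
  case (Cons x xs)
  have "esize x \<le> B" "esize xs \<le> 1 + length xs * (1 + B)"
    using Cons by simp_all
  then show ?case by simp
qed simp

text \<open>This is bounded recursion in the sense of Cobham: all intermediate results must stay
  polynomially small.\<close>

lemma ptime_foldl:
  fixes F :: "'x::enc \<Rightarrow> 's::enc \<Rightarrow> 'y::enc \<Rightarrow> 's"
  assumes "ptime (\<lambda>p. F (fst p) (fst (snd p)) (snd (snd p)))" "ptime i" "ptime xs" "poly_bounded h"
    and size: "\<And>x ys zs. xs x = ys @ zs \<Longrightarrow> esize (foldl (F x) (i x) ys) \<le> h x"
  shows "ptime (\<lambda>x. foldl (F x) (i x) (xs x))"
proof -
  let ?G = "\<lambda>p. case fst p of [] \<Rightarrow> ([], snd p)
    | y # ys \<Rightarrow> (ys, (fst (snd p), F (fst (snd p)) (snd (snd p)) y))"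
  let ?I = "\<lambda>x. (xs x, (x, i x))"
  let ?R = "\<lambda>x. ([] :: 'y list, x, foldl (F x) (i x) (xs x))"
  let ?B = "\<lambda>x. 2 + esize (xs x) + esize x + h x"
  have G: "ptime ?G"
  proof (intro ptime_basic)
    show "ptime (\<lambda>p :: ('y \<times> 'y list) \<times> ('y list \<times> ('x \<times> 's)).
        F (fst (snd (snd p))) (snd (snd (snd p))) (fst (fst p)))"
      using ptime_comp[OF _ assms(1), of "\<lambda>p :: ('y \<times> 'y list) \<times> ('y list \<times> ('x \<times> 's)).
        (fst (snd (snd p)), snd (snd (snd p)), fst (fst p))"] by (simp add: ptime_basic)
  qed
  have iter: "(?G ^^ n) (?I x) = (drop n (xs x), (x, foldl (F x) (i x) (take n (xs x))))"
    if "n \<le> length (xs x)" for n x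
    using that
  proof (induction n)
    case (Suc n)
    then show ?case
      by (simp add: Cons_nth_drop_Suc[symmetric] take_Suc_conv_app_nth)
  qed simp
  have "ptime ?R"
  proof (rule ptime_iterate[OF G _ ])
    show "ptime ?I" by (intro ptime_basic assms)
    show "poly_bounded ?B" by (intro poly_bounded_intros ptime_pb assms)
    fix x
    show "\<exists>n\<le>?B x. fst ((?G ^^ n) (?I x)) = [] \<and> (\<forall>i<n. fst ((?G ^^ i) (?I x)) \<noteq> []) \<and>
      (\<forall>i\<le>n. esize ((?G ^^ i) (?I x)) \<le> ?B x) \<and> (?G ^^ n) (?I x) = ?R x"
    proof (intro exI[of _ "length (xs x)"] conjI allI impI)
      show "length (xs x) \<le> ?B x"
        using length_less_esize[of "xs x"] by simp
      show "esize ((?G ^^ n) (?I x)) \<le> ?B x" if "n \<le> length (xs x)" for n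
        using size[of x "take n (xs x)" "drop n (xs x)"]
          esize_prefix(2)[of "xs x" "take n (xs x)" "drop n (xs x)"] iter[OF that] by simp
    qed (simp_all add: iter del: funpow.simps)
  qed
  from ptime_snd[OF ptime_snd[OF this]] show ?thesis by simp
qed

section \<open>List functions as bounded folds\<close>

lemma ptime_rev:
  fixes xs :: "'a::enc \<Rightarrow> 'b::enc list"
  assumes "ptime xs"
  shows "ptime (\<lambda>x. rev (xs x))"
proof -
  have eq: "foldl (\<lambda>a y. y # a) [] ys = rev ys" for ys :: "'b list"
    by (induction ys rule: rev_induct) simp_all
  have "ptime (\<lambda>x. foldl (\<lambda>a y. y # a) [] (xs x))"
    by (rule ptime_foldl[where h = "\<lambda>x. esize (xs x)"])
      ((intro ptime_basic assms ptime_pb | simp add: eq esize_prefix)+)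
  then show ?thesis by (simp add: eq)
qed

lemma ptime_append:
  fixes xs :: "'a::enc \<Rightarrow> 'b::enc list"
  assumes "ptime xs" "ptime ys"
  shows "ptime (\<lambda>x. xs x @ ys x)"
proof -
  have eq: "foldl (\<lambda>a y. y # a) vs us = rev us @ vs" for us vs :: "'b list"
    by (induction us rule: rev_induct) simp_all
  have "ptime (\<lambda>x. foldl (\<lambda>a y. y # a) (ys x) (rev (xs x)))"
  proof (rule ptime_foldl[where h = "\<lambda>x. esize (xs x) + esize (ys x)"])
    fix x us vs
    assume "rev (xs x) = us @ vs"
    then have "esize us \<le> esize (xs x)"
      by (metis esize_prefix(1) esize_rev)
    then show "esize (foldl (\<lambda>a y. y # a) (ys x) us) \<le> esize (xs x) + esize (ys x)"
      using esize_append[of "rev us" "ys x"] by (simp add: eq)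
  qed (intro ptime_basic ptime_rev poly_bounded_intros ptime_pb assms)+
  then show ?thesis by (simp add: eq)
qed

lemma ptime_map:
  fixes f :: "'a::enc \<Rightarrow> 'b::enc \<Rightarrow> 'c::enc"
  assumes "ptime (\<lambda>p. f (fst p) (snd p))" "ptime xs"
  shows "ptime (\<lambda>x. map (f x) (xs x))"
proof -
  have eq: "foldl (\<lambda>a y. g y # a) [] ys = rev (map g ys)" for g :: "'b \<Rightarrow> 'c" and ys
    by (induction ys rule: rev_induct) simp_all
  obtain q where q: "esize (f x y) \<le> poly q (1 + esize x + esize y)" for x y
    using ptime_pb[OF assms(1)] unfolding poly_bounded_def by (metis esize_Pair fst_conv snd_conv)
  let ?h = "\<lambda>x. 1 + esize (xs x) * (1 + poly q (1 + esize x + esize (xs x)))"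
  have "ptime (\<lambda>x. foldl (\<lambda>a y. f x y # a) [] (xs x))"
  proof (rule ptime_foldl[where h = ?h])
    have "ptime (\<lambda>p. f (fst p) (snd (snd p)))"
      using ptime_comp[OF _ assms(1), of "\<lambda>p. (fst p, snd (snd p))"] by (simp add: ptime_basic)
    then show "ptime (\<lambda>p. f (fst p) (snd (snd p)) # fst (snd p))"
      by (intro ptime_basic)
    fix x ys zs
    assume xs: "xs x = ys @ zs"
    have "esize (f x y) \<le> poly q (1 + esize x + esize (xs x))" if "y \<in> set ys" for y
    proof -
      have "esize y \<le> esize (xs x)"
        using that xs esize_member[of y "xs x"] by simp
      then show ?thesis
        using q[of x y] poly_nat_mono[of "1 + esize x + esize y" "1 + esize x + esize (xs x)" q]
        by simp
    qed
    then have "esize (map (f x) ys) \<le>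
        1 + length (map (f x) ys) * (1 + poly q (1 + esize x + esize (xs x)))"
      by (intro esize_list_bound) auto
    also have "\<dots> \<le> ?h x"
      using length_less_esize[of "xs x"] xs by (intro add_left_mono mult_right_mono) simp_all
    finally show "esize (foldl (\<lambda>a y. f x y # a) [] ys) \<le> ?h x"
      by (simp add: eq)
  qed (intro ptime_basic poly_bounded_intros ptime_pb assms)+
  from ptime_rev[OF this] show ?thesis by (simp add: eq)
qed

lemma ptime_Ball:
  fixes xs :: "'a::enc \<Rightarrow> 'b::enc list"
  assumes "ptime (\<lambda>p. P (fst p) (snd p))" "ptime xs"
  shows "ptime (\<lambda>x. \<forall>y\<in>set (xs x). P x y)"
proof -
  have eq: "foldl (\<lambda>a y. Q y \<and> a) True ys \<longleftrightarrow> (\<forall>y\<in>set ys. Q y)" for Q and ys :: "'b list"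
    by (induction ys rule: rev_induct) auto
  have "ptime (\<lambda>x. foldl (\<lambda>a y. P x y \<and> a) True (xs x))"
  proof (rule ptime_foldl[where h = "\<lambda>_. 3"])
    have "ptime (\<lambda>p. P (fst p) (snd (snd p)))"
      using ptime_comp[OF _ assms(1), of "\<lambda>p. (fst p, snd (snd p))"] by (simp add: ptime_basic)
    then show "ptime (\<lambda>p. P (fst p) (snd (snd p)) \<and> fst (snd p))"
      by (intro ptime_basic)
  qed (intro ptime_basic poly_bounded_intros assms esize_bool)+
  then show ?thesis by (simp add: eq)
qed

lemma ptime_Bex:
  assumes "ptime (\<lambda>p. P (fst p) (snd p))" "ptime xs"
  shows "ptime (\<lambda>x. \<exists>y\<in>set (xs x). P x y)"
  using ptime_not[OF ptime_Ball[OF ptime_not[OF assms(1)] assms(2)]] by simp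

text \<open>A fold cannot stop early. Going from right to left and starting afresh with the empty
  list wherever \<open>P\<close> fails leaves exactly the initial segment.\<close>

lemma ptime_takeWhile:
  fixes xs :: "'a::enc \<Rightarrow> 'b::enc list"
  assumes "ptime (\<lambda>p. P (fst p) (snd p))" "ptime xs"
  shows "ptime (\<lambda>x. takeWhile (P x) (xs x))"
proof -
  have eq: "foldl (\<lambda>a y. if Q y then y # a else []) [] (rev ys) = takeWhile Q ys"
    for Q and ys :: "'b list"
    by (induction ys) simp_all
  have "ptime (\<lambda>x. foldl (\<lambda>a y. if P x y then y # a else []) [] (rev (xs x)))"
  proof (rule ptime_foldl[where h = "\<lambda>x. esize (xs x)"])
    have "ptime (\<lambda>p. P (fst p) (snd (snd p)))"
      using ptime_comp[OF _ assms(1), of "\<lambda>p. (fst p, snd (snd p))"] by (simp add: ptime_basic)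
    then show "ptime (\<lambda>p. if P (fst p) (snd (snd p)) then snd (snd p) # fst (snd p) else [])"
      by (intro ptime_basic)
    fix x us vs
    assume "rev (xs x) = us @ vs"
    then have *: "xs x = rev vs @ rev us" by (metis rev_append rev_rev_ident)
    have "esize (takeWhile (P x) (rev us)) \<le> esize (rev us)"
      by (rule esize_prefix(1)) (rule takeWhile_dropWhile_id[symmetric])
    also have "\<dots> \<le> esize (xs x)" using * by (rule esize_prefix(2))
    finally show "esize (foldl (\<lambda>a y. if P x y then y # a else []) [] us) \<le> esize (xs x)"
      using eq[of "P x" "rev us"] by simp
  qed (intro ptime_basic ptime_rev ptime_pb assms)+
  then show ?thesis by (simp add: eq)
qed

text \<open>The accumulator itself records whether dropping is still in progress: it is empty until
  the first failure of \<open>P\<close> and nonempty ever after.\<close>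

lemma ptime_dropWhile:
  fixes xs :: "'a::enc \<Rightarrow> 'b::enc list"
  assumes "ptime (\<lambda>p. P (fst p) (snd p))" "ptime xs"
  shows "ptime (\<lambda>x. dropWhile (P x) (xs x))"
proof -
  have eq: "foldl (\<lambda>a y. if a = [] \<and> Q y then [] else a @ [y]) [] ys = dropWhile Q ys"
    for Q and ys :: "'b list"
    by (induction ys rule: rev_induct) (auto simp: dropWhile_append dropWhile_eq_Nil_conv)
  have "ptime (\<lambda>x. foldl (\<lambda>a y. if a = [] \<and> P x y then [] else a @ [y]) [] (xs x))"
  proof (rule ptime_foldl[where h = "\<lambda>x. esize (xs x)"])
    have "ptime (\<lambda>p. P (fst p) (snd (snd p)))"
      using ptime_comp[OF _ assms(1), of "\<lambda>p. (fst p, snd (snd p))"] by (simp add: ptime_basic)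
    then show "ptime (\<lambda>p. if fst (snd p) = [] \<and> P (fst p) (snd (snd p)) then []
        else fst (snd p) @ [snd (snd p)])"
      by (intro ptime_basic ptime_null ptime_append)
    fix x us vs
    assume *: "xs x = us @ vs"
    have "esize (dropWhile (P x) us) \<le> esize us"
      by (rule esize_prefix(2)) (rule takeWhile_dropWhile_id[symmetric])
    also have "\<dots> \<le> esize (xs x)" using * by (rule esize_prefix(1))
    finally show "esize (foldl (\<lambda>a y. if a = [] \<and> P x y then [] else a @ [y]) [] us) \<le> esize (xs x)"
      by (simp add: eq)
  qed (intro ptime_basic ptime_pb assms)+
  then show ?thesis by (simp add: eq)
qed

lemma ptime_concat:
  fixes xs :: "'a::enc \<Rightarrow> 'b::enc list list"
  assumes "ptime xs"
  shows "ptime (\<lambda>x. concat (xs x))"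
proof -
  have eq: "foldl (\<lambda>a y. a @ y) [] ys = concat ys" for ys :: "'b list list"
    by (induction ys rule: rev_induct) simp_all
  have size: "esize (concat ys) \<le> esize ys" for ys :: "'b list list"
  proof (induction ys)
    case (Cons y ys)
    then show ?case using esize_append[of y "concat ys"] by simp
  qed simp
  have "ptime (\<lambda>x. foldl (\<lambda>a y. a @ y) [] (xs x))"
  proof (rule ptime_foldl[where h = "\<lambda>x. esize (xs x)"])
    fix x us vs
    assume "xs x = us @ vs"
    then show "esize (foldl (\<lambda>a y. a @ y) [] us) \<le> esize (xs x)"
      using size[of us] esize_prefix(1)[of "xs x" us vs] by (simp add: eq)
  qed (intro ptime_basic ptime_append ptime_pb assms)+
  then show ?thesis by (simp add: eq)
qed

lemma ptime_zip:
  fixes xs :: "'a::enc \<Rightarrow> 'b::enc list" and ys :: "'a \<Rightarrow> 'c::enc list"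
  assumes "ptime xs" "ptime ys"
  shows "ptime (\<lambda>x. zip (xs x) (ys x))"
proof -
  let ?F = "\<lambda>(s :: 'c list \<times> ('b \<times> 'c) list) u. case fst s of [] \<Rightarrow> s | v # vs \<Rightarrow> (vs, (u, v) # snd s)"
  have eq: "foldl ?F (vs, out) us = (drop (length us) vs, rev (zip us vs) @ out)"
    for us :: "'b list" and vs :: "'c list" and out
  proof (induction us arbitrary: vs out)
    case (Cons u us)
    have "foldl ?F ([], out) us = ([], out)" for out
      using Cons.IH[of "[]" out] by simp
    with Cons.IH show ?case by (cases vs) simp_all
  qed simp
  have size: "esize (zip us vs) \<le> esize us + esize vs" for us :: "'b list" and vs :: "'c list"
  proof (induction us arbitrary: vs)
    case (Cons u us)
    then show ?case
    proof (cases vs)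
      case (Cons v vs')
      then show ?thesis using Cons.IH[of vs'] by simp
    qed simp
  qed (use esize_pos in simp)
  have "ptime (\<lambda>x. foldl ?F (ys x, []) (xs x))"
  proof (rule ptime_foldl[where h = "\<lambda>x. 1 + esize (ys x) + (esize (xs x) + esize (ys x))"])
    fix x us vs
    assume "xs x = us @ vs"
    then have "esize us \<le> esize (xs x)" by (rule esize_prefix)
    moreover have "esize (drop (length us) (ys x)) \<le> esize (ys x)"
      by (rule esize_prefix(2)) (rule append_take_drop_id[symmetric])
    ultimately show "esize (foldl ?F (ys x, []) us) \<le>
        1 + esize (ys x) + (esize (xs x) + esize (ys x))"
      using size[of us "ys x"] by (simp add: eq)
  qed (intro ptime_basic poly_bounded_intros ptime_pb assms)+
  from ptime_rev[OF ptime_snd[OF this]] show ?thesis by (simp add: eq)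
qed

text \<open>Here \<open>k\<close> is a constant on which the program may depend: it becomes
  \<open>k\<close> nested case distinctions.\<close>

lemma ptime_take:
  fixes xs :: "'a::enc \<Rightarrow> 'b::enc list"
  assumes "ptime xs"
  shows "ptime (\<lambda>x. take k (xs x))"
proof -
  have "ptime (take k :: 'b list \<Rightarrow> 'b list)"
  proof (induction k)
    case 0
    have "take 0 = (\<lambda>_ :: 'b list. [] :: 'b list)" by auto
    then show ?case by (simp only: ptime_const)
  next
    case (Suc k)
    have "ptime (\<lambda>l :: 'b list. case l of [] \<Rightarrow> [] | y # ys \<Rightarrow> y # take k ys)"
      by (intro ptime_basic ptime_comp[OF _ Suc.IH])
    then show ?case
      by (rule back_subst[of ptime]) (auto simp: fun_eq_iff split: list.split)
  qed
  from ptime_comp[OF assms this] show ?thesis .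
qed

section \<open>Numbers in binary\<close>

fun bits :: "nat \<Rightarrow> bool list" where
  "bits n = (if n = 0 then [] else odd n # bits (n div 2))"

declare bits.simps [simp del]

lemma bits_0 [simp]: "bits 0 = []"
  by (simp add: bits.simps)

lemma bits_eq_Nil [simp]: "bits n = [] \<longleftrightarrow> n = 0"
  by (subst bits.simps) simp

instantiation nat :: enc
begin
definition "to_tree n = to_tree (bits n)"
instance ..
end

lemma length_bits_le: "n < 2 ^ k \<Longrightarrow> length (bits n) \<le> k"
proof (induction k arbitrary: n)
  case (Suc k)
  then show ?case
    by (cases "n = 0") (auto simp: bits.simps[of n])
qed simp

lemma less_length_bits: "n < 2 ^ length (bits n)"
proof (induction n rule: bits.induct)
  case (1 n)
  then show ?case
    by (cases "n = 0") (auto simp: bits.simps[of n])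
qed

lemma less_length_bits_append:
  "n < 2 ^ length (bits n @ bs)" "n < 2 ^ length (bs @ bits n)"
  by (rule less_le_trans[OF less_length_bits power_increasing]; simp)+

lemma esize_bool_list: "esize (bs :: bool list) \<le> 1 + 4 * length bs"
  using esize_list_bound[of bs 3] esize_bool by simp

lemma esize_bits: "esize (n :: nat) = esize (bits n)"
  by (simp add: esize_def to_tree_nat_def)

lemma esize_nat_le: "n < 2 ^ k \<Longrightarrow> esize (n :: nat) \<le> 1 + 4 * k"
  using length_bits_le[of n k] esize_bool_list[of "bits n"] by (simp add: esize_bits)

text \<open>A smaller number may have the longer code, since a bit \<open>True\<close> takes more
  space than a bit \<open>False\<close>. The factor 4 is the size of a list cell holding
  \<open>True\<close>.\<close>

lemma esize_nat_mono: "m \<le> n \<Longrightarrow> esize (m :: nat) \<le> 4 * esize n"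
  using esize_nat_le[of m "length (bits n)"] less_length_bits[of n] length_less_esize[of "bits n"]
  by (simp add: esize_bits)

lemma esize_0 [simp]: "esize (0 :: nat) = 1"
  by (simp add: esize_bits)

lemma ptime_bits: "ptime f \<Longrightarrow> ptime (\<lambda>x. bits (f x))"
  by (erule ptime_retype) (simp add: to_tree_nat_def)

text \<open>With the least significant bit first, halving is \<open>tl\<close>, and doubling below
  is \<open>Cons\<close> except on 0, whose code must stay empty.\<close>

lemma ptime_div2: "ptime f \<Longrightarrow> ptime (\<lambda>x. f x div 2 :: nat)"
proof (rule ptime_retype)
  show "ptime f \<Longrightarrow> ptime (\<lambda>x. tl (bits (f x)))"
    by (intro ptime_tl ptime_bits)
  show "to_tree (f x div 2) = to_tree (tl (bits (f x)))" for x
    by (simp add: to_tree_nat_def bits.simps[of "f x"])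
qed

lemma ptime_odd: "ptime f \<Longrightarrow> ptime (\<lambda>x. odd (f x :: nat))"
proof -
  assume "ptime f"
  then have "ptime (\<lambda>x. case bits (f x) of [] \<Rightarrow> False | b # bs \<Rightarrow> b)"
    by (intro ptime_basic ptime_bits)
  then show ?thesis
    by (rule back_subst[of ptime]) (auto simp: fun_eq_iff bits.simps dest: odd_pos split: list.split)
qed

lemma bits_double: "bits (2 * n + of_bool b) = (if n = 0 \<and> \<not> b then [] else b # bits n)"
  by (subst bits.simps) auto

lemma ptime_zero: "ptime f \<Longrightarrow> ptime (\<lambda>x. f x = (0 :: nat))"
  using ptime_null[OF ptime_bits] by simp

lemma ptime_double:
  assumes "ptime f" "ptime b"
  shows "ptime (\<lambda>x. 2 * f x + of_bool (b x) :: nat)"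
proof (rule ptime_retype)
  show "ptime (\<lambda>x. if f x = 0 \<and> \<not> b x then [] else b x # bits (f x))"
    by (intro ptime_basic ptime_bits ptime_zero assms)
  show "to_tree (2 * f x + of_bool (b x) :: nat) =
      to_tree (if f x = 0 \<and> \<not> b x then [] else b x # bits (f x))" for x
    by (simp only: to_tree_nat_def bits_double)
qed

text \<open>Most significant bit first, in contrast to \<open>bits\<close>.\<close>

definition horner :: "bool list \<Rightarrow> nat" where
  "horner bs = foldl (\<lambda>n b. 2 * n + of_bool b) 0 bs"

lemma horner_simps [simp]: "horner [] = 0" "horner (bs @ [b]) = 2 * horner bs + of_bool b"
  by (simp_all add: horner_def)

lemma horner_Cons: "horner (b # bs) = of_bool b * 2 ^ length bs + horner bs"
proof (induction bs rule: rev_induct)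
  case Nil
  show ?case using horner_simps(2)[of "[]" b] by simp
next
  case (snoc c bs)
  then show ?case using horner_simps(2)[of "b # bs" c] by simp
qed

lemma horner_less: "horner bs < 2 ^ length bs"
  by (induction bs rule: rev_induct) auto

lemma ptime_horner:
  assumes "ptime bs"
  shows "ptime (\<lambda>x. horner (bs x))"
  unfolding horner_def
proof (rule ptime_foldl[where h = "\<lambda>x. 1 + 4 * esize (bs x)"])
  fix x us vs
  assume "bs x = us @ vs"
  then have "length us \<le> esize (bs x)"
    using length_less_esize[of "bs x"] by simp
  then show "esize (foldl (\<lambda>n b. 2 * n + of_bool b) (0 :: nat) us) \<le> 1 + 4 * esize (bs x)"
    using esize_nat_le[OF horner_less[of us]] by (simp add: horner_def)
qed (intro ptime_basic ptime_double poly_bounded_intros ptime_pb assms)+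

text \<open>Addition with carry: the state consists of the unread parts of both numbers, the carry
  and the sum bits so far. The list folded over is only a clock, long enough to use up both numbers.
  As sum bits are pushed in front, the most significant one ends up first, and \<open>horner\<close>
  reads off the value and drops leading zeros.\<close>

lemma ptime_add:
  assumes "ptime f" "ptime g"
  shows "ptime (\<lambda>x. f x + g x :: nat)"
proof -
  let ?F = "\<lambda>s (_ :: bool). (fst s div 2, fst (snd s) div 2,
    (odd (fst s) \<and> odd (fst (snd s))) \<or>
      ((odd (fst s) \<or> odd (fst (snd s))) \<and> fst (snd (snd s))),
    (odd (fst s) \<longleftrightarrow> (odd (fst (snd s)) \<longleftrightarrow> fst (snd (snd s)))) # snd (snd (snd s)))"
  have step: "2 * (m div 2 + n div 2 + of_bool ((odd m \<and> odd n) \<or> ((odd m \<or> odd n) \<and> c))) +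
      of_bool (odd m \<longleftrightarrow> (odd n \<longleftrightarrow> c)) = m + n + of_bool c" for m n :: nat and c
    by (cases "odd m"; cases "odd n"; cases c) (auto elim!: oddE evenE)
  \<comment> \<open>What remains to be added is weighted by 2 to the number of bits already
    produced.\<close>
  have val: "horner (fst (snd (snd (foldl ?F (m, n, c, out) us))) #
        snd (snd (snd (foldl ?F (m, n, c, out) us)))) =
      (m + n + of_bool c) * 2 ^ length out + horner out"
    if "m < 2 ^ length us" "n < 2 ^ length us" for m n :: nat and c out us
    using that
  proof (induction us arbitrary: m n c out)
    case Nil
    then show ?case by (simp add: horner_Cons)
  next
    case (Cons u us)
    let ?c = "(odd m \<and> odd n) \<or> ((odd m \<or> odd n) \<and> c)" and ?o = "odd m \<longleftrightarrow> (odd n \<longleftrightarrow> c)"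
    have "horner (fst (snd (snd (foldl ?F (m, n, c, out) (u # us)))) #
        snd (snd (snd (foldl ?F (m, n, c, out) (u # us))))) =
      horner (fst (snd (snd (foldl ?F (m div 2, n div 2, ?c, ?o # out) us))) #
        snd (snd (snd (foldl ?F (m div 2, n div 2, ?c, ?o # out) us))))"
      by simp
    also have "\<dots> =
      (m div 2 + n div 2 + of_bool ?c) * 2 ^ length (?o # out) + horner (?o # out)"
      by (rule Cons.IH) (use Cons.prems in \<open>simp_all add: less_mult_imp_div_less\<close>)
    also have "\<dots> = (2 * (m div 2 + n div 2 + of_bool ?c) + of_bool ?o) * 2 ^ length out + horner out"
      by (simp add: horner_Cons algebra_simps)
    finally show ?case unfolding step .
  qed
  have bound: "fst (foldl ?F s us) \<le> fst s \<and> fst (snd (foldl ?F s us)) \<le> fst (snd s) \<and>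
      length (snd (snd (snd (foldl ?F s us)))) = length (snd (snd (snd s))) + length us"
    for s :: "nat \<times> nat \<times> bool \<times> bool list" and us
  proof (induction us arbitrary: s)
    case (Cons u us)
    from Cons.IH[of "?F s u"] div_le_dividend[of "fst s" 2] div_le_dividend[of "fst (snd s)" 2]
    show ?case
      by (simp only: foldl.simps fst_conv snd_conv list.size) linarith
  qed simp
  have "ptime (\<lambda>x. foldl ?F (f x, g x, False, []) (bits (f x) @ bits (g x)))" (is "ptime (\<lambda>x. ?S x)")
  proof (rule ptime_foldl[where h = "\<lambda>x. 20 + 8 * esize (f x) + 8 * esize (g x)"])
    fix x us vs
    assume us: "bits (f x) @ bits (g x) = us @ vs"
    have "length us \<le> length (bits (f x)) + length (bits (g x))"
      using arg_cong[OF us, of length] by simp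
    then have "length us \<le> esize (f x) + esize (g x)"
      using length_less_esize[of "bits (f x)"] length_less_esize[of "bits (g x)"]
      by (simp add: esize_bits)
    moreover obtain m n c out where s: "foldl ?F (f x, g x, False, []) us = (m, n, c, out)"
      by (cases "foldl ?F (f x, g x, False, []) us")
    moreover have "m \<le> f x" "n \<le> g x" "length out = length us"
      using bound[of "(f x, g x, False, [])" us] s by simp_all
    ultimately show "esize (foldl ?F (f x, g x, False, []) us) \<le>
        20 + 8 * esize (f x) + 8 * esize (g x)"
      using esize_nat_mono[of m "f x"] esize_nat_mono[of n "g x"] esize_bool[of c]
        esize_bool_list[of out] by simp
  qed (intro ptime_basic ptime_append ptime_bits ptime_div2 ptime_odd poly_bounded_intros ptime_pb assms)+
  then have "ptime (\<lambda>x. horner (fst (snd (snd (?S x))) # snd (snd (snd (?S x)))))"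
    by (intro ptime_horner ptime_basic)
  moreover have "horner (fst (snd (snd (?S x))) # snd (snd (snd (?S x)))) = f x + g x" for x
    by (subst val) (simp_all only: less_length_bits_append, auto)
  ultimately show ?thesis by simp
qed

text \<open>Reading starts at the least significant bits, so the last difference seen is the most
  significant one and decides. The start value \<open>True\<close> settles the case of
  equality.\<close>

lemma ptime_le:
  assumes "ptime f" "ptime g"
  shows "ptime (\<lambda>x. f x \<le> (g x :: nat))"
proof -
  let ?F = "\<lambda>s (_ :: bool). (fst s div 2, fst (snd s) div 2,
    if odd (fst s) \<longleftrightarrow> odd (fst (snd s)) then snd (snd s) else odd (fst (snd s)))"
  have val: "snd (snd (foldl ?F (m, n, c) us)) \<longleftrightarrow> m < n \<or> m = n \<and> c"
    if "m < 2 ^ length us" "n < 2 ^ length us" for m n :: nat and c us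
    using that
  proof (induction us arbitrary: m n c)
    case (Cons u us)
    let ?c = "if odd m \<longleftrightarrow> odd n then c else odd n"
    have "snd (snd (foldl ?F (m, n, c) (u # us))) \<longleftrightarrow>
        snd (snd (foldl ?F (m div 2, n div 2, ?c) us))"
      by simp
    also have "\<dots> \<longleftrightarrow> m div 2 < n div 2 \<or> m div 2 = n div 2 \<and> ?c"
      by (rule Cons.IH) (use Cons.prems in \<open>simp_all add: less_mult_imp_div_less\<close>)
    also have "\<dots> \<longleftrightarrow> m < n \<or> m = n \<and> c"
      by (cases "odd m"; cases "odd n") (auto elim!: oddE evenE, presburger+)
    finally show ?case .
  qed simp
  have bound: "fst (foldl ?F s us) \<le> fst s \<and> fst (snd (foldl ?F s us)) \<le> fst (snd s)"
    for s :: "nat \<times> nat \<times> bool" and us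
  proof (induction us arbitrary: s)
    case (Cons u us)
    from Cons.IH[of "?F s u"] div_le_dividend[of "fst s" 2] div_le_dividend[of "fst (snd s)" 2]
    show ?case
      by (simp only: foldl.simps fst_conv snd_conv list.size) linarith
  qed simp
  have "ptime (\<lambda>x. foldl ?F (f x, g x, True) (bits (f x) @ bits (g x)))"
  proof (rule ptime_foldl[where h = "\<lambda>x. 20 + 8 * esize (f x) + 8 * esize (g x)"])
    fix x us vs
    obtain m n c where s: "foldl ?F (f x, g x, True) us = (m, n, c)"
      by (cases "foldl ?F (f x, g x, True) us")
    moreover have "m \<le> f x" "n \<le> g x"
      using bound[of "(f x, g x, True)" us] s by simp_all
    ultimately show "esize (foldl ?F (f x, g x, True) us) \<le>
        20 + 8 * esize (f x) + 8 * esize (g x)"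
      using esize_nat_mono[of m "f x"] esize_nat_mono[of n "g x"] esize_bool[of c] by simp
  qed (intro ptime_basic ptime_append ptime_bits ptime_div2 ptime_odd poly_bounded_intros ptime_pb assms)+
  then have "ptime (\<lambda>x. snd (snd (foldl ?F (f x, g x, True) (bits (f x) @ bits (g x)))))"
    by (intro ptime_basic)
  moreover have "snd (snd (foldl ?F (f x, g x, True) (bits (f x) @ bits (g x)))) \<longleftrightarrow> f x \<le> g x" for x
    by (subst val) (simp_all only: less_length_bits_append, auto)
  ultimately show ?thesis by simp
qed

lemma ptime_less: "ptime f \<Longrightarrow> ptime g \<Longrightarrow> ptime (\<lambda>x. f x < (g x :: nat))"
  using ptime_not[OF ptime_le, of g f] by (simp add: not_le)

lemma ptime_eq: "ptime f \<Longrightarrow> ptime g \<Longrightarrow> ptime (\<lambda>x. f x = (g x :: nat))"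
  unfolding order.eq_iff by (intro ptime_conj ptime_le)

lemma ptime_min: "ptime f \<Longrightarrow> ptime g \<Longrightarrow> ptime (\<lambda>x. min (f x) (g x :: nat))"
  unfolding min_def by (intro ptime_If ptime_le)

lemma ptime_length:
  fixes xs :: "'a::enc \<Rightarrow> 'b::enc list"
  assumes "ptime xs"
  shows "ptime (\<lambda>x. length (xs x))"
proof -
  have eq: "foldl (\<lambda>n _. n + 1) 0 ys = length ys" for ys :: "'b list"
    by (induction ys rule: rev_induct) simp_all
  have "ptime (\<lambda>x. foldl (\<lambda>n _. n + 1) (0 :: nat) (xs x))"
  proof (rule ptime_foldl[where h = "\<lambda>x. 1 + 4 * esize (xs x)"])
    fix x us vs
    assume "xs x = us @ vs"
    then have "length us \<le> esize (xs x)"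
      using length_less_esize[of "xs x"] by simp
    then show "esize (foldl (\<lambda>n _. n + 1) (0 :: nat) us) \<le> 1 + 4 * esize (xs x)"
      unfolding eq using esize_nat_le[of "length us" "length us"] less_exp[of "length us"] by simp
  qed (intro ptime_basic ptime_add poly_bounded_intros ptime_pb assms)+
  then show ?thesis unfolding eq .
qed

lemma ptime_member: "ptime f \<Longrightarrow> ptime xs \<Longrightarrow> ptime (\<lambda>x. (f x :: nat) \<in> set (xs x))"
proof -
  assume "ptime f" "ptime xs"
  have "ptime (\<lambda>p. f (fst p))"
    using ptime_comp[OF ptime_fst[OF ptime_id] \<open>ptime f\<close>] .
  then have "ptime (\<lambda>x. \<exists>y\<in>set (xs x). f x = y)"
    by (intro ptime_Bex ptime_eq ptime_basic \<open>ptime xs\<close>)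
  then show ?thesis by simp
qed

section \<open>Letters and words\<close>

fun letter_bits :: "letter \<Rightarrow> bool \<times> bool" where
  "letter_bits (Digit b) = (False, b)"
| "letter_bits Comma = (True, False)"
| "letter_bits Semi = (True, True)"

lemma ptime_letter_bits: "ptime f \<Longrightarrow> ptime (\<lambda>x. letter_bits (f x))"
proof (erule ptime_retype)
  show "to_tree (letter_bits (f x)) = to_tree (f x)" for x
    by (cases "f x") (simp_all add: to_tree_prod_def to_tree_bool_def)
qed

lemma ptime_Digit:
  assumes "ptime f"
  shows "ptime (\<lambda>x. Digit (f x))"
  by (rule ptime_retype[OF ptime_Pair[OF ptime_const[of False] assms]])
    (simp add: to_tree_prod_def to_tree_bool_def)

lemma ptime_case_letter:
  assumes "ptime l" "ptime (\<lambda>p. f (fst p) (snd p))" "ptime g" "ptime h"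
  shows "ptime (\<lambda>x. case l x of Digit b \<Rightarrow> f x b | Comma \<Rightarrow> g x | Semi \<Rightarrow> h x)"
proof -
  have "ptime (\<lambda>x. f x (snd (letter_bits (l x))))"
    using ptime_comp[OF ptime_Pair[OF ptime_id ptime_snd[OF ptime_letter_bits[OF assms(1)]]] assms(2)] by simp
  then have "ptime (\<lambda>x. if fst (letter_bits (l x)) then
      (if snd (letter_bits (l x)) then h x else g x) else f x (snd (letter_bits (l x))))"
    by (intro ptime_basic ptime_letter_bits assms)
  then show ?thesis
    by (rule back_subst[of ptime]) (auto split: letter.split)
qed

lemma ptime_eq_letter: "ptime f \<Longrightarrow> ptime g \<Longrightarrow> ptime (\<lambda>x. f x = (g x :: letter))"
proof -
  assume "ptime f" "ptime g"
  then have "ptime (\<lambda>x. (fst (letter_bits (f x)) \<longleftrightarrow> fst (letter_bits (g x))) \<and>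
      (snd (letter_bits (f x)) \<longleftrightarrow> snd (letter_bits (g x))))"
    by (intro ptime_basic ptime_letter_bits)
  moreover have "(fst (letter_bits a) \<longleftrightarrow> fst (letter_bits b)) \<and>
      (snd (letter_bits a) \<longleftrightarrow> snd (letter_bits b)) \<longleftrightarrow> a = b" for a b
    by (cases a; cases b) auto
  ultimately show ?thesis by simp
qed

lemma ptime_eq_word:
  assumes "ptime f" "ptime g"
  shows "ptime (\<lambda>x. f x = (g x :: letter list))"
proof -
  have "ptime (\<lambda>x. length (f x) = length (g x) \<and> (\<forall>p\<in>set (zip (f x) (g x)). fst p = snd p))"
    by (intro ptime_basic ptime_eq ptime_length ptime_Ball ptime_eq_letter ptime_zip assms)
  moreover have "length u = length v \<and> (\<forall>p\<in>set (zip u v). fst p = snd p) \<longleftrightarrow> u = v"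
    for u v :: "letter list"
    using list_all2_iff[of "(=)" u v] by (simp add: list.rel_eq case_prod_unfold)
  ultimately show ?thesis by simp
qed

lemmas ptime_intros = ptime_basic ptime_tl ptime_null ptime_rev ptime_append ptime_map ptime_Ball ptime_Bex ptime_takeWhile
  ptime_dropWhile ptime_concat ptime_zip ptime_take ptime_bits ptime_double ptime_add ptime_le ptime_less ptime_eq ptime_min
  ptime_length ptime_member ptime_Digit ptime_case_letter ptime_eq_word

lemma ptime_comp3:
  assumes "ptime (\<lambda>p. h (fst p) (fst (snd p)) (snd (snd p)))" "ptime f" "ptime g" "ptime j"
  shows "ptime (\<lambda>x. h (f x) (g x) (j x))"
  using ptime_comp[OF ptime_Pair[OF assms(2) ptime_Pair[OF assms(3,4)]] assms(1)] by simp

section \<open>Parsing instances\<close>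

text \<open>The state holds the finished rows and the current row, both reversed, and the value of
  the digits read since the last separator.\<close>

definition parse_step :: "nat list list \<times> nat list \<times> nat \<Rightarrow> letter \<Rightarrow> nat list list \<times> nat list \<times> nat" where
  "parse_step s a = (case a of
     Digit b \<Rightarrow> (fst s, fst (snd s), 2 * snd (snd s) + of_bool b)
   | Comma \<Rightarrow> (fst s, snd (snd s) # fst (snd s), 0)
   | Semi \<Rightarrow> (rev (fst (snd s)) # fst s, [], 0))"

lemma parse_step_simps [simp]:
  "parse_step (R, r, n) (Digit b) = (R, r, 2 * n + of_bool b)"
  "parse_step (R, r, n) Comma = (R, n # r, 0)"
  "parse_step (R, r, n) Semi = (rev r # R, [], 0)"
  by (simp_all add: parse_step_def)

definition parse :: "letter list \<Rightarrow> nat list list" where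
  "parse w = rev (fst (foldl parse_step ([], [], 0) w))"

lemma parse_binary: "foldl parse_step (R, r, 0) (binary n) = (R, r, n)"
proof (induction n rule: binary.induct)
  case (1 n)
  show ?case
  proof (cases "n = 0")
    case True
    then show ?thesis by (simp add: binary.simps)
  next
    case False
    then have "foldl parse_step (R, r, 0) (binary n) = (R, r, 2 * (n div 2) + of_bool (odd n))"
      using 1 by (subst binary.simps) simp
    then show ?thesis by simp
  qed
qed

lemma parse_row: "foldl parse_step (R, [], 0) (encode_row ns) = (ns # R, [], 0)"
proof -
  have "foldl parse_step (R, r, 0) (concat (map (\<lambda>n. binary n @ [Comma]) ns)) = (R, rev ns @ r, 0)" for r
  proof (induction ns arbitrary: r)
    case (Cons n ns)
    then show ?case by (simp add: parse_binary)
  qed simp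
  then show ?thesis by (simp add: encode_row_def)
qed

lemma parse_rows: "parse (concat (map encode_row rows)) = rows"
proof -
  have "foldl parse_step (R, [], 0) (concat (map encode_row rows)) = (rev rows @ R, [], 0)" for R
    by (induction rows arbitrary: R) (simp_all add: parse_row)
  then show ?thesis by (simp add: parse_def)
qed

lemma ptime_parse_step: "ptime s \<Longrightarrow> ptime a \<Longrightarrow> ptime (\<lambda>x. parse_step (s x) (a x))"
proof -
  have "ptime (\<lambda>p. parse_step (fst p) (snd p))"
    unfolding parse_step_def by (intro ptime_intros)
  then show "ptime s \<Longrightarrow> ptime a \<Longrightarrow> ptime (\<lambda>x. parse_step (s x) (a x))"
    by (rule ptime_comp2)
qed

lemma ptime_parse: "ptime parse"
proof -
  \<comment> \<open>A digit adds at most one list cell with a truth value, of size 4, to the current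
    number; separators only rearrange what is there and add a few nodes.\<close>
  have step: "esize (parse_step s a) \<le> esize s + 4" for s a
  proof (cases s; cases a)
    fix R r n b
    assume "s = (R, r, n)" "a = Digit b"
    moreover have "esize (2 * n + of_bool b) \<le> esize n + 4"
      using esize_bool[of b] by (simp add: esize_bits bits_double)
    ultimately show ?thesis by simp
  next
    fix R r n
    assume "s = (R, r, n)" "a = Comma"
    then show ?thesis by simp
  next
    fix R r n
    assume "s = (R, r, n)" "a = Semi"
    then show ?thesis using esize_pos[of n] by simp
  qed
  have size: "esize (foldl parse_step s us) \<le> esize s + 4 * length us" for s us
  proof (induction us arbitrary: s)
    case (Cons u us)
    from Cons.IH[of "parse_step s u"] step[of s u] show ?case by simp
  qed simp
  have "ptime (\<lambda>w. foldl parse_step ([], [], 0) w)"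
  proof (rule ptime_foldl[where h = "\<lambda>w. 20 + 4 * esize w"])
    fix x us vs :: "letter list"
    assume "x = us @ vs"
    then show "esize (foldl parse_step ([], [], 0) us) \<le> 20 + 4 * esize x"
      using size[of "([], [], 0)" us] length_less_esize[of x] by simp
  qed (intro ptime_intros ptime_parse_step poly_bounded_intros)+
  then show ?thesis
    unfolding parse_def by (intro ptime_intros)
qed

lemma binary_bits: "binary n = map Digit (rev (bits n))"
  by (induction n rule: binary.induct) (subst binary.simps, subst bits.simps, simp)

lemma ptime_encode_row: "ptime f \<Longrightarrow> ptime (\<lambda>x. encode_row (f x))"
  unfolding encode_row_def binary_bits by (intro ptime_intros)

text \<open>The rows of voters alternate between rankings and price lists. The first component of
  the state holds a ranking that waits for its prices; an unmatched last row is lost.\<close>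

definition pair_up :: "'a list \<Rightarrow> ('a \<times> 'a) list" where
  "pair_up rows = rev (snd (foldl (\<lambda>s r. case fst s of [] \<Rightarrow> ([r], snd s) | q # qs \<Rightarrow> ([], (q, r) # snd s))
     ([], []) rows))"

lemma pair_up: "pair_up (concat (map (\<lambda>p. [fst p, snd p]) ps)) = ps"
proof -
  have "foldl (\<lambda>s r. case fst s of [] \<Rightarrow> ([r], snd s) | q # qs \<Rightarrow> ([], (q, r) # snd s)) ([], out)
      (concat (map (\<lambda>p. [fst p, snd p]) ps)) = ([], rev ps @ out)" for out
    by (induction ps arbitrary: out) simp_all
  then show ?thesis by (simp add: pair_up_def)
qed

lemma ptime_pair_up:
  fixes f :: "'x::enc \<Rightarrow> 'a::enc list"
  assumes "ptime f"
  shows "ptime (\<lambda>x. pair_up (f x))"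
proof -
  let ?F = "\<lambda>(s :: 'a list \<times> ('a \<times> 'a) list) r. case fst s of [] \<Rightarrow> ([r], snd s)
    | q # qs \<Rightarrow> ([], (q, r) # snd s)"
  have step: "esize (?F s r) \<le> esize s + 2 * (1 + esize r)" for s r
    by (cases s; cases "fst s") auto
  have size: "esize (foldl ?F s us) \<le> esize s + 2 * esize us" for s us
  proof (induction us arbitrary: s)
    case (Cons u us)
    from Cons.IH[of "?F s u"] step[where s = s and r = u] show ?case by simp
  qed simp
  have "ptime (\<lambda>x. foldl ?F ([], []) (f x))"
  proof (rule ptime_foldl[where h = "\<lambda>x. 20 + 2 * esize (f x)"])
    fix x us vs
    assume "f x = us @ vs"
    then show "esize (foldl ?F ([], []) us) \<le> 20 + 2 * esize (f x)"
      using size[of "([], [])" us] esize_prefix(1)[of "f x" us vs] by simp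
  qed (intro ptime_intros poly_bounded_intros ptime_pb assms)+
  then show ?thesis
    unfolding pair_up_def by (intro ptime_intros)
qed

section \<open>Instances as rows of numbers\<close>

type_synonym data = "nat list \<times> nat \<times> nat \<times> (nat list \<times> nat list) list"

definition head0 :: "nat list \<Rightarrow> nat" where
  "head0 l = (case l of [] \<Rightarrow> 0 | x # xs \<Rightarrow> x)"

definition decode_data :: "letter list \<Rightarrow> data" where
  "decode_data w = (let R = parse w in
     (case R of [] \<Rightarrow> [] | r # rs \<Rightarrow> r,
      case tl R of [] \<Rightarrow> 0 | r # rs \<Rightarrow> head0 r,
      case tl R of [] \<Rightarrow> 0 | r # rs \<Rightarrow> head0 (tl r),
      pair_up (tl (tl R))))"

definition encode_data :: "data \<Rightarrow> letter list" where
  "encode_data D = encode_row (fst D) @ encode_row [fst (snd D), fst (snd (snd D))] @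
     concat (map (\<lambda>p. encode_row (fst p) @ encode_row (snd p)) (snd (snd (snd D))))"

lemma decode_encode_data: "decode_data (encode_data D) = D"
proof -
  obtain cs d b vs where D: "D = (cs, d, b, vs)" by (cases D)
  have "concat (map (\<lambda>p. encode_row (fst p) @ encode_row (snd p)) vs) =
      concat (map encode_row (concat (map (\<lambda>p. [fst p, snd p]) vs)))" for vs
    by (induction vs) simp_all
  then have "encode_data D =
      concat (map encode_row (cs # [d, b] # concat (map (\<lambda>p. [fst p, snd p]) vs)))"
    by (simp add: encode_data_def D)
  then have "parse (encode_data D) = cs # [d, b] # concat (map (\<lambda>p. [fst p, snd p]) vs)"
    by (simp only: parse_rows)
  then show ?thesis
    by (simp add: decode_data_def Let_def D head0_def pair_up)
qed

lemma ptime_head0: "ptime f \<Longrightarrow> ptime (\<lambda>x. head0 (f x))"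
  unfolding head0_def by (intro ptime_intros)

lemma ptime_decode_data: "ptime decode_data"
proof -
  have "ptime (\<lambda>R. (case R of [] \<Rightarrow> [] | r # rs \<Rightarrow> r, case tl R of [] \<Rightarrow> 0 | r # rs \<Rightarrow> head0 r,
      case tl R of [] \<Rightarrow> 0 | r # rs \<Rightarrow> head0 (tl r), pair_up (tl (tl R))) :: data)"
    by (intro ptime_intros ptime_head0 ptime_pair_up)
  from ptime_comp[OF ptime_parse this] show ?thesis
    unfolding decode_data_def Let_def .
qed

lemma ptime_encode_data: "ptime encode_data"
  unfolding encode_data_def by (intro ptime_intros ptime_encode_row)


section \<open>Deciding validity\<close>

text \<open>By transitivity it suffices to compare neighbours, which makes sortedness a test of all
  entries of one \<open>zip\<close>.\<close>

lemma sorted_wrt_zip: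
  assumes "transp R"
  shows "sorted_wrt R xs \<longleftrightarrow> (\<forall>p\<in>set (zip xs (tl xs)). R (fst p) (snd p))"
  by (induction xs rule: induct_list012) (simp_all add: sorted_wrt2[OF assms] del: sorted_wrt.simps(2), simp)

text \<open>The part of the ranking from \<open>d\<close> on has as many entries as there are
  possible shifts, the shift by 0 included; this bounds the number of finite prices.\<close>

definition valid_vote :: "nat list \<Rightarrow> nat \<Rightarrow> nat list \<times> nat list \<Rightarrow> bool" where
  "valid_vote cs d p \<longleftrightarrow>
     (\<forall>x\<in>set (fst p). x \<in> set cs) \<and> (\<forall>x\<in>set cs. x \<in> set (fst p)) \<and>
     length (fst p) = length cs \<and> \<not> snd p = [] \<and> head0 (snd p) = 0 \<and>
     (\<forall>q\<in>set (zip (snd p) (tl (snd p))). fst q \<le> snd q) \<and>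
     length (snd p) \<le> length (dropWhile (\<lambda>x. \<not> x = d) (fst p))"

definition valid_data :: "data \<Rightarrow> bool" where
  "valid_data D \<longleftrightarrow> (\<forall>q\<in>set (zip (fst D) (tl (fst D))). fst q < snd q) \<and>
     fst (snd D) \<in> set (fst D) \<and> (\<forall>p\<in>set (snd (snd (snd D))). valid_vote (fst D) (fst (snd D)) p)"

lemma ptime_valid_data: "ptime valid_data"
  unfolding valid_data_def valid_vote_def by (intro ptime_intros ptime_head0)

definition price_of :: "nat list \<Rightarrow> nat \<Rightarrow> enat" where
  "price_of ps i = (if i < length ps then enat (ps ! i) else \<infinity>)"

lemma price_function_finite_prices:
  assumes "price_function m j \<rho>"
  defines "ps \<equiv> finite_prices \<rho>"
  shows "ps \<noteq> []" "head0 ps = 0" "sorted ps" "length ps \<le> Suc (m - j)" "\<rho> = price_of ps"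
proof -
  have \<rho>: "\<rho> 0 = 0" "\<And>i i'. i < i' \<Longrightarrow> i' \<le> m - j \<Longrightarrow> \<rho> i \<le> \<rho> i'" "\<And>i. i > m - j \<Longrightarrow> \<rho> i = \<infinity>"
    using assms(1) by (auto simp: price_function_def)
  \<comment> \<open>The first argument of infinite price. Monotonicity carries the value from there
    up to \<open>m - j\<close>, and beyond it all prices are infinite, so the finite ones form the
    segment below \<open>L\<close>.\<close>
  define L where "L = (LEAST i. \<rho> i = \<infinity>)"
  have L: "\<rho> L = \<infinity>" unfolding L_def using \<rho>(3)[of "Suc (m - j)"] by (intro LeastI) simp
  have L': "L \<le> Suc (m - j)" unfolding L_def using \<rho>(3) by (intro Least_le) simp
  have below: "\<rho> i \<noteq> \<infinity>" if "i < L" for i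
    using that not_less_Least unfolding L_def by blast
  have above: "\<rho> i = \<infinity>" if "i \<ge> L" for i
  proof (cases "i > m - j")
    case False
    then show ?thesis
      using \<rho>(2)[of L i] L that by (cases "L = i") auto
  qed (rule \<rho>(3))
  have "{i. \<rho> i \<noteq> \<infinity>} = {0..<L}"
    using below above by (auto simp: not_le[symmetric])
  then have ps: "ps = map (\<lambda>i. the_enat (\<rho> i)) [0..<L]"
    by (simp add: ps_def finite_prices_def)
  have "L \<noteq> 0" using L \<rho>(1) by (cases "L = 0") auto
  then show "ps \<noteq> []" "head0 ps = 0"
    using \<rho>(1) by (simp_all add: ps head0_def upt_conv_Cons zero_enat_def)
  show "length ps \<le> Suc (m - j)" using L' by (simp add: ps)
  show "\<rho> = price_of ps"
  proof
    show "\<rho> i = price_of ps i" for i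
      using below[of i] above[of i] by (cases "\<rho> i") (auto simp: price_of_def ps not_le[symmetric])
  qed
  show "sorted ps"
    unfolding sorted_iff_nth_mono_less
  proof (intro allI impI)
    fix i i'
    assume i: "i < i'" "i' < length ps"
    then have "\<rho> i \<le> \<rho> i'" using L' by (intro \<rho>(2)) (simp_all add: ps)
    moreover have "\<rho> i \<noteq> \<infinity>" "\<rho> i' \<noteq> \<infinity>" using i below by (simp_all add: ps)
    ultimately show "ps ! i \<le> ps ! i'" using i by (auto simp: ps)
  qed
qed

lemma price_function_price_of:
  assumes "ps \<noteq> []" "head0 ps = 0" "sorted ps" "length ps \<le> Suc (m - j)"
  shows "price_function m j (price_of ps)" "finite_prices (price_of ps) = ps"
proof -
  show "price_function m j (price_of ps)"
    using assms unfolding price_function_def price_of_def head0_def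
    by (auto simp: zero_enat_def sorted_nth_mono split: list.splits)
  have "{i. price_of ps i \<noteq> \<infinity>} = {0..<length ps}"
    by (auto simp: price_of_def)
  then have "finite_prices (price_of ps) = map (\<lambda>i. the_enat (price_of ps i)) [0..<length ps]"
    by (simp add: finite_prices_def)
  also have "\<dots> = map (\<lambda>i. ps ! i) [0..<length ps]"
    by (rule map_cong) (simp_all add: price_of_def)
  finally show "finite_prices (price_of ps) = ps" by (simp add: map_nth)
qed

lemma length_dropWhile_pos:
  assumes "d \<in> set v"
  shows "length (dropWhile (\<lambda>x. x \<noteq> d) v) = Suc (length v - pos v d)"
proof -
  have "length (takeWhile (\<lambda>x. x \<noteq> d) v) + length (dropWhile (\<lambda>x. x \<noteq> d) v) = length v"
    by (simp flip: length_append)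
  moreover have "dropWhile (\<lambda>x. x \<noteq> d) v \<noteq> []"
    using assms by (simp add: dropWhile_eq_Nil_conv)
  then have "length (dropWhile (\<lambda>x. x \<noteq> d) v) > 0" by simp
  ultimately show ?thesis unfolding pos_def by linarith
qed

text \<open>Distinctness follows by counting: a list with the same elements and the same length as a
  distinct list has no room for repetitions.\<close>

lemma is_ranking_iff:
  assumes "distinct cs"
  shows "is_ranking (set cs) v \<longleftrightarrow>
    (\<forall>x\<in>set v. x \<in> set cs) \<and> (\<forall>x\<in>set cs. x \<in> set v) \<and> length v = length cs"
proof -
  have "is_ranking (set cs) v \<longleftrightarrow> set v = set cs \<and> length v = length cs"
    using distinct_card[OF assms] distinct_card[of v] card_distinct[of v]
    unfolding is_ranking_def by auto
  then show ?thesis by auto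
qed

lemma valid_vote_iff:
  assumes "distinct cs" "d \<in> set cs"
  shows "valid_vote cs d (v, ps) \<longleftrightarrow> is_ranking (set cs) v \<and> ps \<noteq> [] \<and> head0 ps = 0 \<and> sorted ps \<and>
    length ps \<le> Suc (card (set cs) - pos v d)"
proof -
  have "(\<forall>q\<in>set (zip ps (tl ps)). fst q \<le> snd q) \<longleftrightarrow> sorted ps"
    using sorted_wrt_zip[of "(\<le>)" ps] by (simp add: transp_def)
  moreover have "length (dropWhile (\<lambda>x. \<not> x = d) v) = Suc (card (set cs) - pos v d)"
    if "is_ranking (set cs) v"
    using length_dropWhile_pos[of d v] that assms distinct_card[of v]
    by (auto simp: is_ranking_def)
  ultimately show ?thesis
    unfolding valid_vote_def using is_ranking_iff[OF assms(1), of v] by auto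
qed

definition data_of :: "nat dsb_instance \<Rightarrow> data" where
  "data_of I = (sorted_list_of_set (candidates I), despised I, budget I,
     map (\<lambda>p. (fst p, finite_prices (snd p))) (voters I))"

lemma encode_data_of: "encode_data (data_of I) = encode_instance I"
  by (simp add: encode_data_def data_of_def encode_instance_def comp_def case_prod_unfold)

lemma valid_data_of:
  assumes "dsb_valid I"
  shows "valid_data (data_of I)"
proof -
  let ?cs = "sorted_list_of_set (candidates I)"
  have fin: "finite (candidates I)" and d: "despised I \<in> candidates I"
    and vs: "\<And>v \<rho>. (v, \<rho>) \<in> set (voters I) \<Longrightarrow> is_ranking (candidates I) v \<and>
      price_function (card (candidates I)) (pos v (despised I)) \<rho>"
    using assms by (auto simp: dsb_valid_def)
  have "\<forall>q\<in>set (zip ?cs (tl ?cs)). fst q < snd q"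
    using sorted_wrt_zip[of "(<)" ?cs] strict_sorted_list_of_set[of "candidates I"]
    by (simp add: transp_def)
  moreover have "valid_vote ?cs (despised I) (v, finite_prices \<rho>)" if "(v, \<rho>) \<in> set (voters I)" for v \<rho>
    using vs[OF that] price_function_finite_prices[of _ _ \<rho>] fin d
    by (subst valid_vote_iff) auto
  ultimately show ?thesis
    using fin d by (auto simp: valid_data_def data_of_def)
qed

lemma valid_data_obtain:
  assumes "valid_data D"
  obtains I where "dsb_valid I" "data_of I = D"
proof -
  obtain cs d b vs where D: "D = (cs, d, b, vs)" by (cases D)
  have strict: "sorted_wrt (<) cs"
    using assms sorted_wrt_zip[of "(<)" cs] by (simp add: D valid_data_def transp_def)
  then have cs: "distinct cs" "sorted cs" "sorted_list_of_set (set cs) = cs"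
    by (simp_all add: strict_sorted_iff sorted_list_of_set_unique sorted_list_of_set.idem_if_sorted_distinct)
  have d: "d \<in> set cs" and vs: "\<And>p. p \<in> set vs \<Longrightarrow> valid_vote cs d (fst p, snd p)"
    using assms by (auto simp: D valid_data_def)
  define I where "I = \<lparr>candidates = set cs, voters = map (\<lambda>p. (fst p, price_of (snd p))) vs,
    despised = d, budget = b\<rparr>"
  have v: "is_ranking (set cs) (fst p)" "price_function (card (set cs)) (pos (fst p) d) (price_of (snd p))"
    "finite_prices (price_of (snd p)) = snd p" if "p \<in> set vs" for p
    using vs[OF that] price_function_price_of[of "snd p"]
    unfolding valid_vote_iff[OF cs(1) d] by auto
  have "dsb_valid I"
    using d v by (auto simp: dsb_valid_def I_def)
  moreover have "data_of I = D"
    using v(3) cs(3) by (simp add: data_of_def I_def D map_idI)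
  ultimately show ?thesis by (rule that)
qed


section \<open>The dynamic program\<close>

text \<open>A choice of a voter is a pair of truth values, each worth one point of advantage for the
  rival, together with a price.\<close>

type_synonym choice = "bool \<times> bool \<times> nat"

text \<open>\<open>x\<close> is the advantage still required and \<open>y\<close> the money left.
  Truncated subtraction forgets any surplus of advantage, so that the requirement is met when it has
  reached 0.\<close>

fun feasible :: "choice list list \<Rightarrow> nat \<Rightarrow> nat \<Rightarrow> bool" where
  "feasible [] x y \<longleftrightarrow> x = 0"
| "feasible (os # oss) x y \<longleftrightarrow> (\<exists>(a, b, p) \<in> set os.
     p \<le> y \<and> feasible oss (x - of_bool a - of_bool b) (y - p))"

text \<open>Entry \<open>x\<close> of a table is the least price of an advantage of at least \<open>x\<close>, where every price
  beyond the budget \<open>B\<close> is recorded as \<open>B + 1\<close>.\<close>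

definition pad :: "bool \<Rightarrow> nat list \<Rightarrow> nat list" where
  "pad b G = (if b then (case G of [] \<Rightarrow> [] | g # gs \<Rightarrow> g # G) else G)"

text \<open>Padding may lengthen the table; \<open>zip\<close> with \<open>H\<close> cuts it
  back.\<close>

definition relax :: "nat list \<Rightarrow> nat list \<Rightarrow> choice \<Rightarrow> nat list" where
  "relax H G q = map (\<lambda>h. min (fst h) (snd h + snd (snd q)))
     (zip H (pad (fst (snd q)) (pad (fst q) G)))"

definition dp_step :: "nat \<Rightarrow> nat list \<Rightarrow> choice list \<Rightarrow> nat list" where
  "dp_step B G os = foldl (\<lambda>H q. relax H G q) (map (\<lambda>_. B + 1) G) os"

text \<open>Without voters only the advantage 0 is available, at price 0. Voters are processed from
  last to first to match the recursion of \<open>feasible\<close>.\<close>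

definition dp :: "nat \<Rightarrow> choice list list \<Rightarrow> nat list" where
  "dp B oss = foldl (dp_step B) (0 # map (\<lambda>_. B + 1) oss) (rev oss)"

text \<open>Repeating entry 0 realises truncated subtraction of indices: a requirement of 0 stays
  0.\<close>

lemma pad_nth: "x < length G \<Longrightarrow> pad b G ! x = G ! (x - of_bool b)"
  by (cases G; cases x) (auto simp: pad_def nth_Cons')

lemma length_pad: "length G \<le> length (pad b G)"
  by (auto simp: pad_def split: list.split)

lemma length_relax: "length H = length G \<Longrightarrow> length (relax H G q) = length G"
  using length_pad[of G "fst q"] length_pad[of "pad (fst q) G" "fst (snd q)"]
  by (simp add: relax_def)

lemma relax_nth:
  assumes "length H = length G" "x < length G"
  shows "relax H G (a, b, p) ! x = min (H ! x) (G ! (x - of_bool a - of_bool b) + p)"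
proof -
  have "x < length (pad a G)" using length_pad[of G a] assms(2) by simp
  moreover have "x < length (pad b (pad a G))" using length_pad[of "pad a G" b] calculation by simp
  moreover have "pad b (pad a G) ! x = G ! (x - of_bool b - of_bool a)"
    using calculation assms(2) by (simp add: pad_nth)
  ultimately show ?thesis
    using assms by (simp add: relax_def diff_commute)
qed

lemma length_dp_step: "length (dp_step B G os) = length G"
proof -
  have "length (foldl (\<lambda>H q. relax H G q) H os) = length G" if "length H = length G" for H
    using that by (induction os arbitrary: H) (simp_all add: length_relax)
  then show ?thesis by (simp add: dp_step_def)
qed

text \<open>Entries are compared only with thresholds up to \<open>B\<close>. The start value
  \<open>B + 1\<close> fails each such test and thus acts as infinity, and minima turn into
  disjunctions.\<close>

lemma dp_step_le:
  assumes "x < length G" "y \<le> B"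
  shows "dp_step B G os ! x \<le> y \<longleftrightarrow>
    (\<exists>(a, b, p) \<in> set os. G ! (x - of_bool a - of_bool b) + p \<le> y)"
proof -
  have "foldl (\<lambda>H q. relax H G q) H os ! x \<le> y \<longleftrightarrow>
    H ! x \<le> y \<or> (\<exists>(a, b, p) \<in> set os. G ! (x - of_bool a - of_bool b) + p \<le> y)"
    if "length H = length G" for H
    using that
  proof (induction os arbitrary: H)
    case (Cons q os)
    obtain a b p where q: "q = (a, b, p)" by (cases q)
    have "relax H G q ! x \<le> y \<longleftrightarrow> H ! x \<le> y \<or> G ! (x - of_bool a - of_bool b) + p \<le> y"
      unfolding q relax_nth[OF Cons.prems assms(1)] by auto
    then show ?case
      using Cons.IH[OF length_relax[OF Cons.prems]] by (simp add: q)
  qed simp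
  then show ?thesis
    using assms by (simp add: dp_step_def)
qed

text \<open>The width \<open>n\<close> of the table is kept apart from the number of voters, since
  the induction removes voters while the width stays.\<close>

lemma foldl_dp_step:
  fixes n :: nat
  assumes "y \<le> B" "x \<le> n"
  shows "length (foldl (dp_step B) (0 # replicate n (B + 1)) (rev oss)) = n + 1"
    and "foldl (dp_step B) (0 # replicate n (B + 1)) (rev oss) ! x \<le> y \<longleftrightarrow> feasible oss x y"
  using assms
proof (induction oss arbitrary: x y)
  case Nil
  { case 2 then show ?case by (cases x) auto }
next
  case (Cons os oss)
  let ?G = "foldl (dp_step B) (0 # replicate n (B + 1)) (rev oss)"
  { case 1 then show ?case using Cons.IH(1)[of y x] by (simp add: length_dp_step) }
  { case 2
    have len: "length ?G = n + 1" using Cons.IH(1)[of y x] 2 by simp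
    have "foldl (dp_step B) (0 # replicate n (B + 1)) (rev (os # oss)) ! x \<le> y \<longleftrightarrow>
        (\<exists>(a, b, p) \<in> set os. ?G ! (x - of_bool a - of_bool b) + p \<le> y)"
      using 2 len by (simp add: dp_step_le)
    also have "\<dots> \<longleftrightarrow> (\<exists>(a, b, p) \<in> set os.
        p \<le> y \<and> ?G ! (x - of_bool a - of_bool b) \<le> y - p)"
      by (intro bex_cong refl) (auto split: prod.split)
    also have "\<dots> \<longleftrightarrow> feasible (os # oss) x y"
      unfolding feasible.simps
    proof (intro bex_cong refl)
      fix q
      show "(case q of (a, b, p) \<Rightarrow> p \<le> y \<and> ?G ! (x - of_bool a - of_bool b) \<le> y - p) \<longleftrightarrow>
          (case q of (a, b, p) \<Rightarrow> p \<le> y \<and> feasible oss (x - of_bool a - of_bool b) (y - p))"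
      proof (cases q)
        case (fields a b p)
        have "x - of_bool a - of_bool b \<le> n" "y - p \<le> B" using 2 by simp_all
        then show ?thesis using Cons.IH(2) fields by simp
      qed
    qed
    finally show ?case . }
qed simp

lemma dp_correct: "length (dp B oss) = length oss + 1" "dp B oss ! length oss \<le> B \<longleftrightarrow> feasible oss (length oss) B"
  using foldl_dp_step[of B B "length oss" "length oss" oss] by (simp_all add: dp_def map_replicate_const)

section \<open>Size and time bounds for the dynamic program\<close>

lemma esize_table:
  assumes "length H \<le> L" "\<And>h. h \<in> set H \<Longrightarrow> h \<le> M"
  shows "esize H \<le> 1 + L * (1 + 4 * esize (M :: nat))"
proof -
  have "esize H \<le> 1 + length H * (1 + 4 * esize M)"
    using assms(2) by (intro esize_list_bound esize_nat_mono)
  also have "\<dots> \<le> 1 + L * (1 + 4 * esize M)"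
    using assms(1) by (intro add_left_mono mult_right_mono) simp_all
  finally show ?thesis .
qed

lemma relax_bounds:
  "length (relax H G q) \<le> length H"
  "\<forall>h\<in>set H. h \<le> M \<Longrightarrow> \<forall>h\<in>set (relax H G q). h \<le> M"
  by (auto simp: relax_def min_le_iff_disj dest: set_zip_leftD)

lemma foldl_relax_bounds:
  assumes "\<forall>h\<in>set H. h \<le> M"
  shows "length (foldl (\<lambda>H q. relax H G q) H os) \<le> length H \<and>
    (\<forall>h\<in>set (foldl (\<lambda>H q. relax H G q) H os). h \<le> M)"
  using assms
proof (induction os arbitrary: H)
  case (Cons q os)
  from Cons.IH[OF relax_bounds(2)[OF Cons.prems, where G = G and q = q]] relax_bounds(1)[of H G q] show ?case
    by (auto intro: le_trans)
qed simp

text \<open>The cap holds whatever \<open>G\<close> contains, because the minimum starts from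
  \<open>B + 1\<close>. So entries keep polynomial binary length, however many prices are
  added.\<close>

lemma dp_step_bounds: "\<forall>h\<in>set (dp_step B G os). h \<le> B + 1"
  unfolding dp_step_def using foldl_relax_bounds[of "map (\<lambda>_. B + 1) G" "B + 1" G os] by auto

lemma ptime_pad: "ptime b \<Longrightarrow> ptime G \<Longrightarrow> ptime (\<lambda>x. pad (b x) (G x))"
proof -
  have "ptime (\<lambda>p. pad (fst p) (snd p))"
    unfolding pad_def by (intro ptime_intros)
  then show "ptime b \<Longrightarrow> ptime G \<Longrightarrow> ptime (\<lambda>x. pad (b x) (G x))"
    by (rule ptime_comp2)
qed

lemma ptime_relax: "ptime H \<Longrightarrow> ptime G \<Longrightarrow> ptime q \<Longrightarrow> ptime (\<lambda>x. relax (H x) (G x) (q x))"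
proof -
  have "ptime (\<lambda>p. relax (fst p) (fst (snd p)) (snd (snd p)))"
    unfolding relax_def by (intro ptime_intros ptime_pad)
  then show "ptime H \<Longrightarrow> ptime G \<Longrightarrow> ptime q \<Longrightarrow> ptime (\<lambda>x. relax (H x) (G x) (q x))"
    by (rule ptime_comp3)
qed

lemma ptime_dp_step: "ptime B \<Longrightarrow> ptime G \<Longrightarrow> ptime os \<Longrightarrow> ptime (\<lambda>x. dp_step (B x) (G x) (os x))"
proof -
  have "ptime (\<lambda>p. dp_step (fst p) (fst (snd p)) (snd (snd p)))"
    unfolding dp_step_def
  proof (rule ptime_foldl)
    show "poly_bounded (\<lambda>p :: nat \<times> nat list \<times> choice list.
        1 + esize (fst (snd p)) * (1 + 4 * esize (fst p + 1)))"
      by (intro poly_bounded_intros ptime_pb ptime_intros)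
    fix p :: "nat \<times> nat list \<times> choice list" and us vs
    show "esize (foldl (\<lambda>H q. relax H (fst (snd p)) q) (map (\<lambda>_. fst p + 1) (fst (snd p))) us)
        \<le> 1 + esize (fst (snd p)) * (1 + 4 * esize (fst p + 1))"
      using foldl_relax_bounds[of "map (\<lambda>_. fst p + 1) (fst (snd p))" "fst p + 1" "fst (snd p)" us]
        length_less_esize[of "fst (snd p)"]
      by (intro esize_table) auto
  qed (intro ptime_intros ptime_relax)+
  then show "ptime B \<Longrightarrow> ptime G \<Longrightarrow> ptime os \<Longrightarrow> ptime (\<lambda>x. dp_step (B x) (G x) (os x))"
    by (rule ptime_comp3)
qed

lemma ptime_dp: "ptime B \<Longrightarrow> ptime oss \<Longrightarrow> ptime (\<lambda>x. dp (B x) (oss x))"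
proof -
  have bounds: "length (foldl (dp_step B) G us) = length G \<and> (\<forall>h \<in> set (foldl (dp_step B) G us). h \<le> B + 1)"
    if "\<forall>h \<in> set G. h \<le> B + 1" for B G us
    using that
  proof (induction us arbitrary: G)
    case (Cons u us)
    from Cons.IH[OF dp_step_bounds[of B G u]] show ?case by (simp add: length_dp_step)
  qed simp
  have "ptime (\<lambda>p. dp (fst p) (snd p))"
    unfolding dp_def
  proof (rule ptime_foldl)
    show "poly_bounded (\<lambda>p :: nat \<times> choice list list. 1 + (1 + esize (snd p)) * (1 + 4 * esize (fst p + 1)))"
      by (intro poly_bounded_intros ptime_pb ptime_intros)
    fix p :: "nat \<times> choice list list" and us vs
    show "esize (foldl (dp_step (fst p)) (0 # map (\<lambda>_. fst p + 1) (snd p)) us)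
        \<le> 1 + (1 + esize (snd p)) * (1 + 4 * esize (fst p + 1))"
      using bounds[of "0 # map (\<lambda>_. fst p + 1) (snd p)" "fst p" us] length_less_esize[of "snd p"]
      by (intro esize_table) auto
  qed (intro ptime_intros ptime_dp_step)+
  then show "ptime B \<Longrightarrow> ptime oss \<Longrightarrow> ptime (\<lambda>x. dp (B x) (oss x))"
    by (rule ptime_comp2)
qed


section \<open>The choices of a voter\<close>

definition gain_choice :: "nat \<Rightarrow> nat \<Rightarrow> nat \<Rightarrow> nat list \<Rightarrow> nat \<Rightarrow> choice" where
  "gain_choice k c d v p = (c \<in> set (take k v), \<not> d \<in> set (take k v), p)"

text \<open>The state holds the candidates before \<open>d\<close>, those behind \<open>d\<close>,
  and the choices found so far. Each price moves \<open>d\<close> one place further, so all shifts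
  are listed in one pass over the prices.\<close>

definition shift_step :: "nat \<Rightarrow> nat \<Rightarrow> nat \<Rightarrow> nat list \<times> nat list \<times> choice list \<Rightarrow> nat \<Rightarrow>
    nat list \<times> nat list \<times> choice list" where
  "shift_step k c d s p =
     (case fst (snd s) of [] \<Rightarrow> fst s | y # ys \<Rightarrow> fst s @ [y],
      tl (fst (snd s)),
      gain_choice k c d (fst s @ d # fst (snd s)) p # snd (snd s))"

lemma shift_step_simp [simp]:
  "shift_step k c d (xs, ys, out) p =
    (case ys of [] \<Rightarrow> xs | z # zs \<Rightarrow> xs @ [z], tl ys, gain_choice k c d (xs @ d # ys) p # out)"
  by (simp add: shift_step_def split: list.split)

definition choices :: "nat \<Rightarrow> nat \<Rightarrow> nat \<Rightarrow> nat list \<times> nat list \<Rightarrow> choice list" where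
  "choices k c d vp = snd (snd (foldl (shift_step k c d)
     (takeWhile (\<lambda>x. \<not> x = d) (fst vp), tl (dropWhile (\<lambda>x. \<not> x = d) (fst vp)), []) (snd vp)))"

lemma foldl_shift_step:
  "foldl (shift_step k c d) (xs, ys, []) ps =
    (xs @ take (length ps) ys, drop (length ps) ys,
     rev (map (\<lambda>t. gain_choice k c d (xs @ take t ys @ d # drop t ys) (ps ! t)) [0..<length ps]))"
proof (induction ps rule: rev_induct)
  case (snoc p ps)
  have "(case drop (length ps) ys of [] \<Rightarrow> xs @ take (length ps) ys
      | z # zs \<Rightarrow> (xs @ take (length ps) ys) @ [z]) = xs @ take (Suc (length ps)) ys"
    by (cases "length ps < length ys")
      (simp_all add: Cons_nth_drop_Suc[symmetric] take_Suc_conv_app_nth)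
  moreover have "map (\<lambda>t. gain_choice k c d (xs @ take t ys @ d # drop t ys) ((ps @ [p]) ! t)) [0..<length ps] =
      map (\<lambda>t. gain_choice k c d (xs @ take t ys @ d # drop t ys) (ps ! t)) [0..<length ps]"
    by (rule map_cong) (simp_all add: nth_append)
  ultimately show ?case
    by (simp add: snoc drop_Suc tl_drop)
qed simp

lemma set_choices:
  "set (choices k c d (v, ps)) =
    (\<lambda>t. gain_choice k c d (shift_back d t v) (ps ! t)) ` {..<length ps}"
  by (simp add: choices_def foldl_shift_step shift_back_def Let_def lessThan_atLeast0)

lemma ptime_choices: "ptime c \<Longrightarrow> ptime d \<Longrightarrow> ptime vp \<Longrightarrow> ptime (\<lambda>x. choices k (c x) (d x) (vp x))"
proof -
  have "ptime (\<lambda>q. choices k (fst q) (fst (snd q)) (snd (snd q)))"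
  proof -
    let ?xs = "\<lambda>q :: nat \<times> nat \<times> nat list \<times> nat list.
      takeWhile (\<lambda>x. \<not> x = fst (snd q)) (fst (snd (snd q)))"
    let ?ys = "\<lambda>q :: nat \<times> nat \<times> nat list \<times> nat list.
      tl (dropWhile (\<lambda>x. \<not> x = fst (snd q)) (fst (snd (snd q))))"
    let ?ps = "\<lambda>q :: nat \<times> nat \<times> nat list \<times> nat list. snd (snd (snd q))"
    have "ptime (\<lambda>q. foldl (shift_step k (fst q) (fst (snd q))) (?xs q, ?ys q, []) (?ps q))"
    proof (rule ptime_foldl)
      show "poly_bounded (\<lambda>q. 2 + (esize (?xs q) + esize (?ys q)) + esize (?ys q) + 9 * esize (?ps q))"
        by (intro poly_bounded_intros ptime_pb ptime_intros)
      show "ptime (\<lambda>p. shift_step k (fst (fst p)) (fst (snd (fst p))) (fst (snd p)) (snd (snd p)))"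
        unfolding shift_step_def gain_choice_def by (intro ptime_intros)
      fix q us vs
      assume ps: "?ps q = us @ vs"
      have 1: "esize (?xs q @ take (length us) (?ys q)) \<le> esize (?xs q) + esize (?ys q)"
        using esize_append[of "?xs q" "take (length us) (?ys q)"]
          esize_prefix(1)[of "?ys q" "take (length us) (?ys q)" "drop (length us) (?ys q)"] by simp
      have 2: "esize (drop (length us) (?ys q)) \<le> esize (?ys q)"
        by (rule esize_prefix(2)) (rule append_take_drop_id[symmetric])
      have "esize (map (\<lambda>t. gain_choice k c d (w t) (us ! t)) [0..<length us]) \<le> 9 * esize us"
        for c d w
      proof -
        \<comment> \<open>The 8 consists of two pair nodes and two truth values of size at most
          3.\<close>
        have "esize (gain_choice k c d (w t) p) \<le> 8 + esize p" for t p
          using esize_bool[of "c \<in> set (take k (w t))"] esize_bool[of "\<not> d \<in> set (take k (w t))"]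
          by (simp add: gain_choice_def)
        then have "1 + esize (gain_choice k c d (w t) p) \<le> 9 * (1 + esize p)" for t p
          by (rule order_trans[OF add_left_mono]) simp
        then have "sum_list (map (\<lambda>t. 1 + esize (gain_choice k c d (w t) (us ! t))) [0..<length us]) \<le>
            sum_list (map (\<lambda>t. 9 * (1 + esize (us ! t))) [0..<length us])"
          by (intro sum_list_mono)
        also have "\<dots> = sum_list (map (\<lambda>p. 9 * (1 + esize p)) (map ((!) us) [0..<length us]))"
          by (simp add: comp_def)
        also have "\<dots> = 9 * sum_list (map (\<lambda>p. 1 + esize p) us)"
          by (simp only: map_nth sum_list_const_mult)
        finally show ?thesis
          by (simp add: esize_sum_list comp_def)
      qed
      then have 3: "esize (map (\<lambda>t. gain_choice k (fst q) (fst (snd q)) (?xs q @ take t (?ys q) @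
          fst (snd q) # drop t (?ys q)) (us ! t)) [0..<length us]) \<le> 9 * esize (?ps q)"
        using esize_prefix(1)[OF ps] by (meson le_trans mult_le_mono2)
      show "esize (foldl (shift_step k (fst q) (fst (snd q))) (?xs q, ?ys q, []) us) \<le>
          2 + (esize (?xs q) + esize (?ys q)) + esize (?ys q) + 9 * esize (?ps q)"
        unfolding foldl_shift_step esize_Pair esize_rev using 1 2 3 by linarith
    qed (intro ptime_intros)+
    then show ?thesis
      unfolding choices_def by (intro ptime_intros)
  qed
  then show "ptime c \<Longrightarrow> ptime d \<Longrightarrow> ptime vp \<Longrightarrow> ptime (\<lambda>x. choices k (c x) (d x) (vp x))"
    by (rule ptime_comp3)
qed

text \<open>The entry for advantage \<open>n\<close> is the last one of the table;
  \<open>rev\<close> brings it to the front, where a case distinction can reach it.\<close>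

definition beats :: "nat \<Rightarrow> data \<Rightarrow> nat \<Rightarrow> bool" where
  "beats k D c \<longleftrightarrow>
     (case rev (dp (fst (snd (snd D))) (map (choices k c (fst (snd D))) (snd (snd (snd D))))) of
       [] \<Rightarrow> False | g # gs \<Rightarrow> g \<le> fst (snd (snd D)))"

lemma beats_iff:
  "beats k (cs, d, B, vs) c \<longleftrightarrow> feasible (map (choices k c d) vs) (length vs) B"
proof -
  let ?G = "dp B (map (choices k c d) vs)"
  have len: "length ?G = Suc (length vs)"
    using dp_correct(1)[of B "map (choices k c d) vs"] by simp
  have ne: "?G \<noteq> []"
  proof
    assume "?G = []"
    with len show False by simp
  qed
  then have "rev ?G \<noteq> []" "hd (rev ?G) = ?G ! length vs"
    using last_conv_nth[OF ne] len by (simp_all add: hd_rev)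
  then have eq: "rev ?G = ?G ! length vs # tl (rev ?G)"
    by (metis list.collapse)
  have "beats k (cs, d, B, vs) c \<longleftrightarrow> (case rev ?G of [] \<Rightarrow> False | g # gs \<Rightarrow> g \<le> B)"
    unfolding beats_def fst_conv snd_conv ..
  also have "\<dots> \<longleftrightarrow> ?G ! length vs \<le> B"
    by (subst eq) simp
  finally show ?thesis
    using dp_correct(2)[of B "map (choices k c d) vs"] by simp
qed

definition yes_data :: "nat \<Rightarrow> data \<Rightarrow> bool" where
  "yes_data k D \<longleftrightarrow> (\<exists>c\<in>set (fst D). \<not> c = fst (snd D) \<and> beats k D c)"

lemma ptime_yes_data: "ptime (yes_data k)"
  unfolding yes_data_def beats_def by (intro ptime_intros ptime_dp ptime_choices)


section \<open>Correctness\<close>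

definition gain :: "nat \<Rightarrow> nat \<Rightarrow> nat \<Rightarrow> nat list \<Rightarrow> nat" where
  "gain k c d v = of_bool (c \<in> set (take k v)) + of_bool (d \<notin> set (take k v))"

text \<open>Requirements passed from voter to voter add up to one sum, because
  \<open>x - g \<le> s\<close> is equivalent to \<open>x \<le> g + s\<close> even for truncated
  subtraction. For prices the guard \<open>p \<le> y\<close> excludes truncation.\<close>

lemma feasible_choices:
  "feasible (map (choices k c d) vs) x y \<longleftrightarrow>
    (\<exists>t. (\<forall>i<length vs. t i < length (snd (vs ! i))) \<and>
      x \<le> (\<Sum>i<length vs. gain k c d (shift_back d (t i) (fst (vs ! i)))) \<and>
      (\<Sum>i<length vs. snd (vs ! i) ! t i) \<le> y)" (is "_ \<longleftrightarrow> ?R vs x y")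
proof (induction vs arbitrary: x y)
  case (Cons vp vs)
  obtain v ps where vp: "vp = (v, ps)" by (cases vp)
  have "feasible (map (choices k c d) (vp # vs)) x y \<longleftrightarrow>
      (\<exists>t0<length ps. ps ! t0 \<le> y \<and>
        feasible (map (choices k c d) vs) (x - gain k c d (shift_back d t0 v)) (y - ps ! t0))"
    by (simp add: vp set_choices gain_choice_def gain_def diff_diff_left Bex_def)
  also have "\<dots> \<longleftrightarrow>
      (\<exists>t0<length ps. ps ! t0 \<le> y \<and> ?R vs (x - gain k c d (shift_back d t0 v)) (y - ps ! t0))"
    by (simp only: Cons.IH)
  also have "\<dots> \<longleftrightarrow> ?R (vp # vs) x y"
  proof
    assume "\<exists>t0<length ps. ps ! t0 \<le> y \<and> ?R vs (x - gain k c d (shift_back d t0 v)) (y - ps ! t0)"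
    then obtain t0 t where t: "t0 < length ps" "ps ! t0 \<le> y" "\<forall>i<length vs. t i < length (snd (vs ! i))"
      "x - gain k c d (shift_back d t0 v) \<le> (\<Sum>i<length vs. gain k c d (shift_back d (t i) (fst (vs ! i))))"
      "(\<Sum>i<length vs. snd (vs ! i) ! t i) \<le> y - ps ! t0" by blast
    let ?t = "\<lambda>i. case i of 0 \<Rightarrow> t0 | Suc j \<Rightarrow> t j"
    show "?R (vp # vs) x y"
    proof (intro exI[of _ ?t] conjI allI impI)
      show "?t i < length (snd ((vp # vs) ! i))" if "i < length (vp # vs)" for i
        using that t by (cases i) (auto simp: vp)
      show "x \<le> (\<Sum>i<length (vp # vs). gain k c d (shift_back d (?t i) (fst ((vp # vs) ! i))))"
        using t by (simp add: sum.lessThan_Suc_shift vp del: sum.lessThan_Suc)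
      show "(\<Sum>i<length (vp # vs). snd ((vp # vs) ! i) ! ?t i) \<le> y"
        using t by (simp add: sum.lessThan_Suc_shift vp del: sum.lessThan_Suc)
    qed
  next
    assume "?R (vp # vs) x y"
    then obtain t where t: "\<forall>i<length (vp # vs). t i < length (snd ((vp # vs) ! i))"
      "x \<le> (\<Sum>i<length (vp # vs). gain k c d (shift_back d (t i) (fst ((vp # vs) ! i))))"
      "(\<Sum>i<length (vp # vs). snd ((vp # vs) ! i) ! t i) \<le> y" by blast
    have "?R vs (x - gain k c d (shift_back d (t 0) v)) (y - ps ! t 0)"
    proof (intro exI[of _ "\<lambda>i. t (Suc i)"] conjI allI impI)
      show "t (Suc i) < length (snd (vs ! i))" if "i < length vs" for i
        using t(1)[rule_format, of "Suc i"] that by simp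
    qed (use t(2,3) in \<open>simp_all add: sum.lessThan_Suc_shift vp del: sum.lessThan_Suc\<close>)
    moreover have "t 0 < length ps" "ps ! t 0 \<le> y"
      using t(1)[rule_format, of 0] t(3)
      by (auto simp: sum.lessThan_Suc_shift vp simp del: sum.lessThan_Suc)
    ultimately show "\<exists>t0<length ps. ps ! t0 \<le> y \<and>
        ?R vs (x - gain k c d (shift_back d t0 v)) (y - ps ! t0)" by blast
  qed
  finally show ?case .
qed simp

section \<open>Approval points and unique winners\<close>

lemma in_set_take_iff:
  "c \<in> set v \<Longrightarrow> c \<in> set (take k v) \<longleftrightarrow> length (takeWhile (\<lambda>x. x \<noteq> c) v) < k"
proof (induction v arbitrary: k)
  case (Cons a v)
  then show ?case by (cases k) auto
qed simp

lemma approval_points: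
  assumes "is_ranking C v" "c \<in> C"
  shows "(replicate (min k (card C)) 1 @ replicate (card C - k) 0) ! (pos v c - 1) =
    (of_bool (c \<in> set (take k v)) :: nat)"
proof -
  have c: "c \<in> set v" and len: "length v = card C"
    using assms distinct_card[of v] by (auto simp: is_ranking_def)
  have "length (takeWhile (\<lambda>x. x \<noteq> c) v) < card C"
    using in_set_take_iff[OF c, of "card C"] c len by simp
  then show ?thesis
    using in_set_take_iff[OF c, of k] by (auto simp: pos_def nth_append)
qed

lemma is_ranking_shift_back:
  assumes "is_ranking C v" "d \<in> C"
  shows "is_ranking C (shift_back d t v)"
proof -
  let ?ys = "tl (dropWhile (\<lambda>x. x \<noteq> d) v)" and ?xs = "takeWhile (\<lambda>x. x \<noteq> d) v"
  have "dropWhile (\<lambda>x. x \<noteq> d) v \<noteq> []"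
    using assms by (simp add: is_ranking_def dropWhile_eq_Nil_conv)
  then have "dropWhile (\<lambda>x. x \<noteq> d) v = d # ?ys"
    using hd_dropWhile[of "\<lambda>x. x \<noteq> d" v] by (metis list.collapse)
  then have v: "v = ?xs @ d # ?ys"
    by (metis takeWhile_dropWhile_id)
  have "mset (shift_back d t v) = mset v"
  proof -
    have "mset (take t ?ys) + mset (drop t ?ys) = mset ?ys"
      by (simp flip: mset_append)
    then have "mset (shift_back d t v) = mset (?xs @ d # ?ys)"
      by (simp add: shift_back_def Let_def)
    with v show ?thesis by simp
  qed
  then have "distinct (shift_back d t v) \<longleftrightarrow> distinct v" "set (shift_back d t v) = set v"
    by (rule mset_eq_imp_distinct_iff, rule mset_eq_setD)
  then show ?thesis
    using assms(1) by (simp add: is_ranking_def)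
qed

text \<open>If \<open>d\<close> is the sole winner, it has the top score, and a rival with at least
  that score would win too. So one rival is a sufficient witness, and its score is compared with
  that of \<open>d\<close> alone.\<close>

lemma unique_winner_iff:
  assumes "d \<in> C"
  shows "scoring_rule \<alpha> C V \<noteq> {d} \<longleftrightarrow>
    (\<exists>c\<in>C. c \<noteq> d \<and> score (\<alpha> (card C)) V d \<le> score (\<alpha> (card C)) V c)"
proof -
  let ?s = "score (\<alpha> (card C)) V"
  have W: "c \<in> scoring_rule \<alpha> C V \<longleftrightarrow> c \<in> C \<and> (\<forall>c'\<in>C. ?s c' \<le> ?s c)" for c
    by (simp add: scoring_rule_def)
  show ?thesis
  proof (cases "\<exists>c\<in>C. c \<noteq> d \<and> ?s d \<le> ?s c")
    case True
    then obtain c where c: "c \<in> C" "c \<noteq> d" "?s d \<le> ?s c" by blast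
    have "scoring_rule \<alpha> C V \<noteq> {d}"
    proof
      assume eq: "scoring_rule \<alpha> C V = {d}"
      then have "\<forall>c'\<in>C. ?s c' \<le> ?s d" using W[of d] by simp
      then have "\<forall>c'\<in>C. ?s c' \<le> ?s c" using c(3) le_trans by blast
      then have "c \<in> scoring_rule \<alpha> C V" using W[of c] c(1) by blast
      with eq c(2) show False by simp
    qed
    with True show ?thesis by simp
  next
    case False
    then have less: "?s c < ?s d" if "c \<in> C" "c \<noteq> d" for c
      using that not_le by blast
    have "c \<in> scoring_rule \<alpha> C V \<longleftrightarrow> c = d" for c
    proof
      assume "c \<in> scoring_rule \<alpha> C V"
      then have "c \<in> C" "?s d \<le> ?s c" using W[of c] assms by auto
      with less[of c] show "c = d" by (meson not_le)
    next
      assume "c = d"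
      have "?s c' \<le> ?s d" if "c' \<in> C" for c'
        using less[OF that] by (cases "c' = d") simp_all
      with \<open>c = d\<close> assms W[of d] show "c \<in> scoring_rule \<alpha> C V" by simp
    qed
    then have "scoring_rule \<alpha> C V = {d}" by blast
    with False show ?thesis by simp
  qed
qed

text \<open>One infinite price makes the sum infinite, so a finite budget forces every shift to lie
  within its price list.\<close>

lemma sum_prices_le_iff:
  fixes n :: nat
  shows "(\<Sum>i<n. price_of (ps i) (t i)) \<le> enat B \<longleftrightarrow>
    (\<forall>i<n. t i < length (ps i)) \<and> (\<Sum>i<n. ps i ! t i) \<le> B"
proof (cases "\<forall>i<n. t i < length (ps i)")
  case True
  have sum_enat: "(\<Sum>i<m. enat (f i)) = enat (\<Sum>i<m. f i)" for f and m :: nat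
    by (induction m) (simp_all add: zero_enat_def)
  have "(\<Sum>i<n. price_of (ps i) (t i)) = (\<Sum>i<n. enat (ps i ! t i))"
    by (rule sum.cong) (use True in \<open>simp_all add: price_of_def\<close>)
  with True show ?thesis unfolding sum_enat by simp
next
  case False
  then obtain i where i: "i < n" "\<not> t i < length (ps i)" by blast
  have "price_of (ps i) (t i) \<le> (\<Sum>i<n. price_of (ps i) (t i))"
    by (rule member_le_sum) (use i(1) in simp_all)
  then have "(\<Sum>i<n. price_of (ps i) (t i)) = \<infinity>"
    using i(2) by (simp add: price_of_def)
  with i show ?thesis by auto
qed

lemma yes_data_of:
  assumes "dsb_valid I"
  shows "dsb_yes (k_approval k) I \<longleftrightarrow> yes_data k (data_of I)"
proof -
  let ?C = "candidates I" and ?d = "despised I" and ?n = "length (voters I)"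
  let ?v = "\<lambda>i. fst (voters I ! i)" and ?ps = "\<lambda>i. finite_prices (snd (voters I ! i))"
  let ?V = "\<lambda>t. mset (map (\<lambda>i. shift_back ?d (t i) (?v i)) [0..<?n])"
  have fin: "finite ?C" and d: "?d \<in> ?C"
    using assms by (auto simp: dsb_valid_def)
  have v: "is_ranking ?C (?v i)" and price: "snd (voters I ! i) = price_of (?ps i)" if "i < ?n" for i
  proof -
    have "voters I ! i \<in> set (voters I)" using that by simp
    then have *: "is_ranking ?C (?v i)" "price_function (card ?C) (pos (?v i) ?d) (snd (voters I ! i))"
      using assms by (auto simp: dsb_valid_def case_prod_unfold)
    show "is_ranking ?C (?v i)" "snd (voters I ! i) = price_of (?ps i)"
      using * price_function_finite_prices(5) by blast+
  qed
  have score: "score (replicate (min k (card ?C)) 1 @ replicate (card ?C - k) 0) (?V t) c =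
      (\<Sum>i<?n. of_bool (c \<in> set (take k (shift_back ?d (t i) (?v i)))))" if "c \<in> ?C" for t c
  proof -
    have "score (replicate (min k (card ?C)) 1 @ replicate (card ?C - k) 0) (?V t) c =
        (\<Sum>i\<leftarrow>[0..<?n]. (replicate (min k (card ?C)) 1 @ replicate (card ?C - k) 0) !
          (pos (shift_back ?d (t i) (?v i)) c - 1))"
      by (simp add: score_def sum_mset_sum_list comp_def flip: mset_map)
    also have "\<dots> = (\<Sum>i<?n. (replicate (min k (card ?C)) 1 @ replicate (card ?C - k) 0) !
          (pos (shift_back ?d (t i) (?v i)) c - 1))"
      by (simp add: interv_sum_list_conv_sum_set_nat lessThan_atLeast0)
    also have "\<dots> = (\<Sum>i<?n. of_bool (c \<in> set (take k (shift_back ?d (t i) (?v i)))))"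
      by (intro sum.cong refl approval_points is_ranking_shift_back v d that) simp
    finally show ?thesis .
  qed
  have winner: "k_approval k ?C (?V t) \<noteq> {?d} \<longleftrightarrow>
      (\<exists>c\<in>?C. c \<noteq> ?d \<and> ?n \<le> (\<Sum>i<?n. gain k c ?d (shift_back ?d (t i) (?v i))))" for t
  proof -
    have "(\<Sum>i<?n. of_bool (?d \<in> set (take k (shift_back ?d (t i) (?v i))))) \<le>
        (\<Sum>i<?n. of_bool (c \<in> set (take k (shift_back ?d (t i) (?v i)))) :: nat) \<longleftrightarrow>
      ?n \<le> (\<Sum>i<?n. gain k c ?d (shift_back ?d (t i) (?v i)))" for c
    proof -
      \<comment> \<open>\<open>G\<close> is the total gain, \<open>A\<close> and \<open>D\<close>
        are the approvals of the rival and of \<open>d\<close>; the identity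
        \<open>G = n + A - D\<close> is written without subtraction.\<close>
      have key: "G + D = A + n \<Longrightarrow> D \<le> A \<longleftrightarrow> n \<le> G" for A D G n :: nat
        by linarith
      have "(\<Sum>i<?n. gain k c ?d (shift_back ?d (t i) (?v i))) +
          (\<Sum>i<?n. of_bool (?d \<in> set (take k (shift_back ?d (t i) (?v i))))) =
        (\<Sum>i<?n. of_bool (c \<in> set (take k (shift_back ?d (t i) (?v i)))) + 1)"
        unfolding sum.distrib[symmetric] by (intro sum.cong refl) (simp add: gain_def)
      also have "\<dots> = (\<Sum>i<?n. of_bool (c \<in> set (take k (shift_back ?d (t i) (?v i))))) + ?n"
        unfolding sum.distrib by simp
      finally show ?thesis by (rule key)
    qed
    then show ?thesis
      unfolding k_approval_def unique_winner_iff[OF d] using score d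
      by (intro bex_cong refl) auto
  qed
  have "dsb_yes (k_approval k) I \<longleftrightarrow> (\<exists>t. (\<Sum>i<?n. price_of (?ps i) (t i)) \<le> enat (budget I) \<and>
      (\<exists>c\<in>?C. c \<noteq> ?d \<and> ?n \<le> (\<Sum>i<?n. gain k c ?d (shift_back ?d (t i) (?v i)))))"
  proof -
    have "(\<Sum>i<?n. snd (voters I ! i) (t i)) = (\<Sum>i<?n. price_of (?ps i) (t i))" for t
      by (rule sum.cong[OF refl]) (simp add: price[symmetric])
    then show ?thesis unfolding dsb_yes_def winner by (simp only:)
  qed
  \<comment> \<open>The two existential quantifiers are exchanged: a rival is fixed before the
    shifts, which makes the points additive over the voters.\<close>
  also have "\<dots> \<longleftrightarrow> (\<exists>c\<in>?C. c \<noteq> ?d \<and> (\<exists>t. (\<forall>i<?n. t i < length (?ps i)) \<and>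
      ?n \<le> (\<Sum>i<?n. gain k c ?d (shift_back ?d (t i) (?v i))) \<and> (\<Sum>i<?n. ?ps i ! t i) \<le> budget I))"
    unfolding sum_prices_le_iff by blast
  also have "\<dots> \<longleftrightarrow> yes_data k (data_of I)"
    unfolding yes_data_def data_of_def beats_iff feasible_choices using fin by simp
  finally show ?thesis .
qed

text \<open>Decoding is total and lenient; comparing the word with the encoding of what was decoded
  rejects every malformed word.\<close>

definition decide :: "nat \<Rightarrow> letter list \<Rightarrow> bool" where
  "decide k w \<longleftrightarrow> encode_data (decode_data w) = w \<and> valid_data (decode_data w) \<and> yes_data k (decode_data w)"

lemma ptime_decide: "ptime (decide k)"
  unfolding decide_def
  by (intro ptime_intros ptime_decode_data ptime_comp[OF ptime_decode_data ptime_encode_data]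
      ptime_comp[OF ptime_decode_data ptime_valid_data] ptime_comp[OF ptime_decode_data ptime_yes_data])

theorem theorem1:
  fixes k :: nat
  shows "destructive_shift_bribery (k_approval k) \<in> class_P"
proof -
  have "decide k w \<longleftrightarrow> w \<in> destructive_shift_bribery (k_approval k)" for w
  proof
    assume w: "decide k w"
    then obtain I where I: "dsb_valid I" "data_of I = decode_data w"
      by (auto simp: decide_def elim: valid_data_obtain)
    have "encode_instance I = w"
      using w I(2) by (metis decide_def encode_data_of)
    moreover have "dsb_yes (k_approval k) I"
      using w I yes_data_of by (simp add: decide_def)
    ultimately show "w \<in> destructive_shift_bribery (k_approval k)"
      using I(1) unfolding destructive_shift_bribery_def by blast
  next
    assume "w \<in> destructive_shift_bribery (k_approval k)"
    then obtain I where I: "w = encode_instance I" "dsb_valid I" "dsb_yes (k_approval k) I"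
      unfolding destructive_shift_bribery_def by blast
    \<comment> \<open>\<open>decode_data\<close> inverts the encoding, so whichever instance
      witnesses membership, its data are those decoded from \<open>w\<close>.\<close>
    have "decode_data w = data_of I"
      using I(1) decode_encode_data[of "data_of I"] by (simp add: encode_data_of)
    then show "decide k w"
      using I valid_data_of yes_data_of by (simp add: decide_def encode_data_of)
  qed
  then have "destructive_shift_bribery (k_approval k) = {w. decide k w}"
    by blast
  then show ?thesis
    using ptime_class_P[OF ptime_decide] by simp
qed

end
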